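(* Let $f$ be a continuous probability density function on $\mathbb{R}_+$, and assume that there exists $\eta>0$ such that $f(x)>0$ for all $x\in\,]0,\eta]$. Then there exists a random compact measured metric space $(S,d,\mu)$ that achieves the distribution on $\mathbb{R}_+$ with density $f$.
   Context: Notation: $\mathbb{R}_+=[0,\infty[$ and $]0,\eta]$ is the half-open interval excluding $0$. Densities are with respect to Lebesgue measure. A compact measured metric space is a compact metric space $(S,d)$ endowed with a Borel probability measure $\mu$ on $S$. Let $\mathbb{M}$ be the space of compact measured metric spaces seen up to measure-preserving isometry, write $[S,d,\mu]$ for the class of $(S,d,\mu)$, and equip $\mathbb{M}$ with the Gromov--Hausdorff--Prokhorov metric $$D([S_1,d_1,\mu_1],[S_2,d_2,\mu_2])=\inf_{\phi_1,\phi_2}\max\left(d_{\mathrm H}(\phi_1(S_1),\phi_2(S_2)),\,d_{\mathrm P}(\mu_1\circ\phi_1^{-1},\mu_2\circ\phi_2^{-1})\right),$$ where the infimum is over all isometric embeddings $\phi_1:S_1\to S$ and $\phi_2:S_2\to S$ into some common metric space $(S,d)$, $d_{\mathrm H}$ is the Hausdorff distance between non-empty compact subsets of $S$, and $d_{\mathrm P}$ is the Prokhorov distance between Borel probability measures on $S$. The space $(\mathbb{M},D)$ is separable and complete and is equipped with its Borel $\sigma$-algebra. A random compact measured metric space is a random variable with values in $\mathbb{M}$. It achieves a distribution $\theta$ on $\mathbb{R}_+$ if the following annealed distribution equals $\theta$: first sample $[S,d,\mu]$, then conditionally on it sample two independent random variables $\xi_1,\xi_2$ with distribution $\mu$, and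 take the (unconditional) distribution of $d(\xi_1,\xi_2)$. That is, for every Borel set $B\subset\mathbb{R}_+$, $\theta(B)=\mathbb{E}\left[\kappa([S,d,\mu],B)\right]$, where $\kappa$ is the Markov kernel from $\mathbb{M}$ to $\mathbb{R}_+$ given by $\kappa([S,d,\mu],B)=\int_S\int_S\mathbf{1}(d(s_1,s_2)\in B)\,\mathrm{d}\mu(s_2)\,\mathrm{d}\mu(s_1)$. *)

theory Defs
  imports "HOL-Probability.Probability"
begin

definition metric_borel :: "'a metric \<Rightarrow> 'a measure" where
  "metric_borel m = sigma (mspace m) {U. openin (mtopology_of m) U}"

definition isometric_embedding :: "'a metric \<Rightarrow> 'b metric \<Rightarrow> ('a \<Rightarrow> 'b) \<Rightarrow> bool" where
  "isometric_embedding m1 m2 \<phi> \<longleftrightarrow>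
     \<phi> ` mspace m1 \<subseteq> mspace m2 \<and>
     (\<forall>x\<in>mspace m1. \<forall>y\<in>mspace m1. mdist m2 (\<phi> x) (\<phi> y) = mdist m1 x y)"

definition hausdorff_dist :: "'a metric \<Rightarrow> 'a set \<Rightarrow> 'a set \<Rightarrow> real" where
  "hausdorff_dist m A B =
     max (SUP a\<in>A. INF b\<in>B. mdist m a b) (SUP b\<in>B. INF a\<in>A. mdist m a b)"

definition metric_nbhd :: "'a metric \<Rightarrow> real \<Rightarrow> 'a set \<Rightarrow> 'a set" where
  "metric_nbhd m \<epsilon> A = {x \<in> mspace m. \<exists>a\<in>A. mdist m a x < \<epsilon>}"

definition prokhorov_dist :: "'a metric \<Rightarrow> 'a measure \<Rightarrow> 'a measure \<Rightarrow> real" where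
  "prokhorov_dist m \<mu> \<nu> =
     Inf {\<epsilon>. 0 < \<epsilon> \<and> (\<forall>A\<in>sets (metric_borel m).
       measure \<mu> A \<le> measure \<nu> (metric_nbhd m \<epsilon> A) + \<epsilon> \<and>
       measure \<nu> A \<le> measure \<mu> (metric_nbhd m \<epsilon> A) + \<epsilon>)}"

text \<open>A compact metric space has at most continuum many points, so every compact measured
  metric space is isometric to one whose points are real numbers. The type real serves
  only as a set of labels here; its own metric and topology play no role.\<close>

definition compact_mm_space :: "real metric \<times> real measure \<Rightarrow> bool" where
  "compact_mm_space = (\<lambda>(m, \<mu>).
     compact_space (mtopology_of m) \<and> prob_space \<mu> \<and>
     space \<mu> = mspace m \<and> sets \<mu> = sets (metric_borel m))"

definition mm_isometric :: "real metric \<times> real measure \<Rightarrow> real metric \<times> real measure \<Rightarrow> bool" where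
  "mm_isometric = (\<lambda>(m1, \<mu>1) (m2, \<mu>2).
     compact_mm_space (m1, \<mu>1) \<and> compact_mm_space (m2, \<mu>2) \<and>
     (\<exists>\<phi>. isometric_embedding m1 m2 \<phi> \<and> \<phi> ` mspace m1 = mspace m2 \<and>
          distr \<mu>1 (metric_borel m2) \<phi> = \<mu>2))"

lemma openin_mtopology_of_Pow: "{U. openin (mtopology_of m) U} \<subseteq> Pow (mspace m)"
  using openin_subset[of "mtopology_of m"] unfolding topspace_mtopology_of by blast

lemma space_metric_borel [simp]: "space (metric_borel m) = mspace m"
  unfolding metric_borel_def by (rule space_measure_of[OF openin_mtopology_of_Pow])

lemma sets_metric_borel:
  "sets (metric_borel m) = sigma_sets (mspace m) {U. openin (mtopology_of m) U}"
  unfolding metric_borel_def by (rule sets_measure_of[OF openin_mtopology_of_Pow])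

lemma isometric_embedding_id: "isometric_embedding m m (\<lambda>x. x)"
  by (auto simp: isometric_embedding_def)

lemma isometric_embedding_comp:
  "isometric_embedding m1 m2 \<phi> \<Longrightarrow> isometric_embedding m2 m3 \<psi> \<Longrightarrow>
   isometric_embedding m1 m3 (\<psi> \<circ> \<phi>)"
  by (auto simp: isometric_embedding_def image_subset_iff)

lemma isometric_embedding_inj: "isometric_embedding m1 m2 \<phi> \<Longrightarrow> inj_on \<phi> (mspace m1)"
  unfolding isometric_embedding_def inj_on_def by (metis mdist_zero)

lemma isometric_embedding_measurable:
  assumes "isometric_embedding m1 m2 \<phi>"
  shows "\<phi> \<in> metric_borel m1 \<rightarrow>\<^sub>M metric_borel m2"
proof -
  have "Lipschitz_continuous_map m1 m2 \<phi>"
    using assms unfolding Lipschitz_continuous_map_def isometric_embedding_def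
    by (intro conjI exI[of _ 1]) auto
  then have cont: "continuous_map (mtopology_of m1) (mtopology_of m2) \<phi>"
    by (rule Lipschitz_continuous_imp_continuous_map)
  show ?thesis
    unfolding metric_borel_def[of m2]
  proof (rule measurable_measure_of)
    fix U assume "U \<in> {U. openin (mtopology_of m2) U}"
    then have "openin (mtopology_of m1) {x \<in> topspace (mtopology_of m1). \<phi> x \<in> U}"
      using cont by (auto simp: continuous_map_def)
    moreover have "\<phi> -` U \<inter> space (metric_borel m1) = {x \<in> topspace (mtopology_of m1). \<phi> x \<in> U}"
      by auto
    ultimately show "\<phi> -` U \<inter> space (metric_borel m1) \<in> sets (metric_borel m1)"
      by (auto simp: sets_metric_borel intro: sigma_sets.Basic)
  next
    show "{U. openin (mtopology_of m2) U} \<subseteq> Pow (mspace m2)"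
      by (rule openin_mtopology_of_Pow)
    show "\<phi> \<in> space (metric_borel m1) \<rightarrow> mspace m2"
      using assms by (auto simp: isometric_embedding_def)
  qed
qed

lemma mm_isometric_measurable:
  assumes "compact_mm_space (m1, \<mu>1)" "isometric_embedding m1 m2 \<phi>"
  shows "\<phi> \<in> \<mu>1 \<rightarrow>\<^sub>M metric_borel m2"
proof -
  have "sets \<mu>1 = sets (metric_borel m1)"
    using assms(1) by (simp add: compact_mm_space_def)
  from measurable_cong_sets[OF this refl] isometric_embedding_measurable[OF assms(2)]
  show ?thesis by blast
qed

lemma mm_isometric_refl: "compact_mm_space X \<Longrightarrow> mm_isometric X X"
proof (cases X)
  fix m \<mu> assume X: "X = (m, \<mu>)" and c: "compact_mm_space X"
  have "distr \<mu> (metric_borel m) (\<lambda>x. x) = \<mu>"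
    using c X by (intro distr_id2) (auto simp: compact_mm_space_def)
  then show ?thesis
    using c X isometric_embedding_id[of m] by (auto simp: mm_isometric_def intro!: exI[of _ "\<lambda>x. x"])
qed

lemma mm_isometric_sym:
  assumes "mm_isometric X Y" shows "mm_isometric Y X"
proof -
  obtain m1 \<mu>1 m2 \<mu>2 where XY: "X = (m1, \<mu>1)" "Y = (m2, \<mu>2)" by (cases X, cases Y)
  from assms XY obtain \<phi> where
    c: "compact_mm_space (m1, \<mu>1)" "compact_mm_space (m2, \<mu>2)" and
    iso: "isometric_embedding m1 m2 \<phi>" and im: "\<phi> ` mspace m1 = mspace m2" and
    d: "distr \<mu>1 (metric_borel m2) \<phi> = \<mu>2"
    by (auto simp: mm_isometric_def)
  define \<psi> where "\<psi> = the_inv_into (mspace m1) \<phi>"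
  have inj: "inj_on \<phi> (mspace m1)" by (rule isometric_embedding_inj[OF iso])
  have l: "\<psi> (\<phi> x) = x" if "x \<in> mspace m1" for x
    using that inj by (simp add: \<psi>_def the_inv_into_f_f)
  have iso': "isometric_embedding m2 m1 \<psi>"
    unfolding isometric_embedding_def im[symmetric] image_image ball_simps
    using iso by (simp add: l isometric_embedding_def)
  have im': "\<psi> ` mspace m2 = mspace m1"
    unfolding im[symmetric] image_image by (simp add: l)
  have mphi: "\<phi> \<in> \<mu>1 \<rightarrow>\<^sub>M metric_borel m2" by (rule mm_isometric_measurable[OF c(1) iso])
  have "distr \<mu>2 (metric_borel m1) \<psi> = distr \<mu>1 (metric_borel m1) (\<psi> \<circ> \<phi>)"
    unfolding d[symmetric]
    by (rule distr_distr[OF isometric_embedding_measurable[OF iso'] mphi])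
  also have "\<dots> = distr \<mu>1 (metric_borel m1) (\<lambda>x. x)"
    using c(1) l by (intro distr_cong) (auto simp: compact_mm_space_def)
  also have "\<dots> = \<mu>1"
    using c(1) by (intro distr_id2) (auto simp: compact_mm_space_def)
  finally show ?thesis
    using c iso' im' XY by (auto simp: mm_isometric_def)
qed

lemma mm_isometric_trans:
  assumes "mm_isometric X Y" "mm_isometric Y Z" shows "mm_isometric X Z"
proof -
  obtain m1 \<mu>1 m2 \<mu>2 m3 \<mu>3 where XYZ: "X = (m1, \<mu>1)" "Y = (m2, \<mu>2)" "Z = (m3, \<mu>3)"
    by (cases X, cases Y, cases Z)
  from assms XYZ obtain \<phi> \<psi> where
    c: "compact_mm_space (m1, \<mu>1)" "compact_mm_space (m2, \<mu>2)" "compact_mm_space (m3, \<mu>3)" and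
    iso: "isometric_embedding m1 m2 \<phi>" "isometric_embedding m2 m3 \<psi>" and
    im: "\<phi> ` mspace m1 = mspace m2" "\<psi> ` mspace m2 = mspace m3" and
    d: "distr \<mu>1 (metric_borel m2) \<phi> = \<mu>2" "distr \<mu>2 (metric_borel m3) \<psi> = \<mu>3"
    by (auto simp: mm_isometric_def)
  have "distr \<mu>1 (metric_borel m3) (\<psi> \<circ> \<phi>) = \<mu>3"
    using distr_distr[OF isometric_embedding_measurable[OF iso(2)]
        mm_isometric_measurable[OF c(1) iso(1)]] d by simp
  moreover have "(\<psi> \<circ> \<phi>) ` mspace m1 = mspace m3"
    unfolding im(2)[symmetric] im(1)[symmetric] by (simp add: image_image)
  ultimately show ?thesis
    using c isometric_embedding_comp[OF iso] XYZ
    by (auto simp: mm_isometric_def intro!: exI[of _ "\<psi> \<circ> \<phi>"])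
qed

lemma compact_mm_space_exists: "\<exists>X. compact_mm_space X"
proof -
  define m where "m = submetric euclidean_metric {0::real}"
  have ms: "mspace m = {0}"
    by (simp add: m_def)
  have "compact_space (mtopology_of m)"
    by (simp add: m_def mtopology_of_submetric compact_space_subtopology)
  moreover have "prob_space (return (metric_borel m) 0)"
    using ms by (intro prob_space_return) simp
  ultimately have "compact_mm_space (m, return (metric_borel m) 0)"
    by (simp add: compact_mm_space_def)
  then show ?thesis ..
qed

lemma part_equivp_mm_isometric: "part_equivp mm_isometric"
proof (rule part_equivpI)
  show "\<exists>X. mm_isometric X X"
    using compact_mm_space_exists mm_isometric_refl by blast
  show "symp mm_isometric"
    by (rule sympI) (rule mm_isometric_sym)
  show "transp mm_isometric"
    by (rule transpI) (rule mm_isometric_trans)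
qed

text \<open>Compact measured metric spaces up to measure-preserving isometry.\<close>

quotient_type mm_space = "real metric \<times> real measure" / partial: mm_isometric
  by (rule part_equivp_mm_isometric)

text \<open>The common space may be cut down to the union of the two images without changing either
  distance, so it too may be labelled by real numbers. The set of values is non-empty because
  a common space always exists (a disjoint union with a large constant cross-distance).\<close>

definition ghp_values :: "real metric \<times> real measure \<Rightarrow> real metric \<times> real measure \<Rightarrow> real set" where
  "ghp_values = (\<lambda>(m1, \<mu>1) (m2, \<mu>2).
     {max (hausdorff_dist m (\<phi>1 ` mspace m1) (\<phi>2 ` mspace m2))
          (prokhorov_dist m (distr \<mu>1 (metric_borel m) \<phi>1) (distr \<mu>2 (metric_borel m) \<phi>2))
      | (m :: real metric) \<phi>1 \<phi>2.
        isometric_embedding m1 m \<phi>1 \<and> isometric_embedding m2 m \<phi>2})"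

lemma ghp_values_mono:
  assumes "mm_isometric X X'" "mm_isometric Y Y'"
  shows "ghp_values X' Y' \<subseteq> ghp_values X Y"
proof
  fix v assume v: "v \<in> ghp_values X' Y'"
  obtain m1 \<mu>1 m1' \<mu>1' m2 \<mu>2 m2' \<mu>2' where
    eq: "X = (m1, \<mu>1)" "X' = (m1', \<mu>1')" "Y = (m2, \<mu>2)" "Y' = (m2', \<mu>2')"
    by (cases X, cases X', cases Y, cases Y')
  from v eq obtain m :: "real metric" and \<phi>1 \<phi>2 where
    iso: "isometric_embedding m1' m \<phi>1" "isometric_embedding m2' m \<phi>2" and
    v_eq: "v = max (hausdorff_dist m (\<phi>1 ` mspace m1') (\<phi>2 ` mspace m2'))
          (prokhorov_dist m (distr \<mu>1' (metric_borel m) \<phi>1) (distr \<mu>2' (metric_borel m) \<phi>2))"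
    by (auto simp: ghp_values_def)
  from assms(1) eq obtain \<psi>1 where
    1: "compact_mm_space (m1, \<mu>1)" "isometric_embedding m1 m1' \<psi>1"
      "\<psi>1 ` mspace m1 = mspace m1'" "distr \<mu>1 (metric_borel m1') \<psi>1 = \<mu>1'"
    by (auto simp: mm_isometric_def)
  from assms(2) eq obtain \<psi>2 where
    2: "compact_mm_space (m2, \<mu>2)" "isometric_embedding m2 m2' \<psi>2"
      "\<psi>2 ` mspace m2 = mspace m2'" "distr \<mu>2 (metric_borel m2') \<psi>2 = \<mu>2'"
    by (auto simp: mm_isometric_def)
  have d1: "distr \<mu>1' (metric_borel m) \<phi>1 = distr \<mu>1 (metric_borel m) (\<phi>1 \<circ> \<psi>1)"
    using distr_distr[OF isometric_embedding_measurable[OF iso(1)]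
        mm_isometric_measurable[OF 1(1,2)]] 1(4) by simp
  have d2: "distr \<mu>2' (metric_borel m) \<phi>2 = distr \<mu>2 (metric_borel m) (\<phi>2 \<circ> \<psi>2)"
    using distr_distr[OF isometric_embedding_measurable[OF iso(2)]
        mm_isometric_measurable[OF 2(1,2)]] 2(4) by simp
  have im: "\<phi>1 ` mspace m1' = (\<phi>1 \<circ> \<psi>1) ` mspace m1" "\<phi>2 ` mspace m2' = (\<phi>2 \<circ> \<psi>2) ` mspace m2"
    using 1(3)[symmetric] 2(3)[symmetric] by (simp_all add: image_image)
  show "v \<in> ghp_values X Y"
    unfolding v_eq d1 d2 im ghp_values_def eq prod.case
    by (rule CollectI, intro exI conjI, rule refl, rule isometric_embedding_comp[OF 1(2) iso(1)],
        rule isometric_embedding_comp[OF 2(2) iso(2)])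
qed

lift_definition ghp_dist :: "mm_space \<Rightarrow> mm_space \<Rightarrow> real" is
  "\<lambda>X Y. Inf (ghp_values X Y)"
proof -
  fix X X' Y Y' assume "mm_isometric X X'" "mm_isometric Y Y'"
  then have "ghp_values X Y = ghp_values X' Y'"
    by (metis ghp_values_mono mm_isometric_sym subset_antisym)
  then show "Inf (ghp_values X Y) = Inf (ghp_values X' Y')" by simp
qed

definition ghp_borel :: "mm_space measure" where
  "ghp_borel = sigma UNIV {U. Metric_space.mopen UNIV ghp_dist U}"

lemma nn_integral_distr_le:
  assumes "\<phi> \<in> M \<rightarrow>\<^sub>M N"
  shows "(\<integral>\<^sup>+y. g y \<partial>distr M N \<phi>) \<le> (\<integral>\<^sup>+x. g (\<phi> x) \<partial>M)"
  unfolding nn_integral_def[of "distr M N \<phi>"]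
proof (rule SUP_least)
  fix s assume s: "s \<in> {s. simple_function (distr M N \<phi>) s \<and> s \<le> g}"
  then have "integral\<^sup>S (distr M N \<phi>) s = (\<integral>\<^sup>+y. s y \<partial>distr M N \<phi>)"
    by (simp add: nn_integral_eq_simple_integral)
  also have "\<dots> = (\<integral>\<^sup>+x. s (\<phi> x) \<partial>M)"
    using s by (intro nn_integral_distr assms)
      (auto dest: borel_measurable_simple_function)
  also have "\<dots> \<le> (\<integral>\<^sup>+x. g (\<phi> x) \<partial>M)"
    using s by (intro nn_integral_mono) (auto simp: le_fun_def)
  finally show "integral\<^sup>S (distr M N \<phi>) s \<le> (\<integral>\<^sup>+x. g (\<phi> x) \<partial>M)" .
qed

definition pair_distance_prob :: "real metric \<times> real measure \<Rightarrow> real set \<Rightarrow> ennreal" where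
  "pair_distance_prob = (\<lambda>(m, \<mu>) B. \<integral>\<^sup>+s1. \<integral>\<^sup>+s2. indicator B (mdist m s1 s2) \<partial>\<mu> \<partial>\<mu>)"

lemma pair_distance_prob_le:
  assumes "mm_isometric X Y"
  shows "pair_distance_prob Y B \<le> pair_distance_prob X B"
proof -
  obtain m1 \<mu>1 m2 \<mu>2 where XY: "X = (m1, \<mu>1)" "Y = (m2, \<mu>2)" by (cases X, cases Y)
  from assms XY obtain \<phi> where
    c: "compact_mm_space (m1, \<mu>1)" and
    iso: "isometric_embedding m1 m2 \<phi>" and
    d: "distr \<mu>1 (metric_borel m2) \<phi> = \<mu>2"
    by (auto simp: mm_isometric_def)
  have mphi: "\<phi> \<in> \<mu>1 \<rightarrow>\<^sub>M metric_borel m2" by (rule mm_isometric_measurable[OF c iso])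
  have sp: "space \<mu>1 = mspace m1" using c by (simp add: compact_mm_space_def)
  have "pair_distance_prob Y B \<le>
      (\<integral>\<^sup>+s1. \<integral>\<^sup>+s2. indicator B (mdist m2 (\<phi> s1) s2) \<partial>\<mu>2 \<partial>\<mu>1)"
    unfolding pair_distance_prob_def XY
    using nn_integral_distr_le[OF mphi, of "\<lambda>s1. \<integral>\<^sup>+s2. indicator B (mdist m2 s1 s2) \<partial>\<mu>2"]
    by (simp add: d)
  also have "\<dots> \<le> (\<integral>\<^sup>+s1. \<integral>\<^sup>+s2. indicator B (mdist m2 (\<phi> s1) (\<phi> s2)) \<partial>\<mu>1 \<partial>\<mu>1)"
    using nn_integral_distr_le[OF mphi] d by (intro nn_integral_mono) simp
  also have "\<dots> = pair_distance_prob X B"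
    unfolding pair_distance_prob_def XY prod.case using iso
    by (intro nn_integral_cong) (simp add: sp isometric_embedding_def)
  finally show ?thesis .
qed

text \<open>The kernel mapping the class of (S, d, \<mu>) and a Borel set B to the probability that two
  independent points with distribution \<mu> have their distance in B.\<close>

lift_definition distance_kernel :: "mm_space \<Rightarrow> real set \<Rightarrow> ennreal" is pair_distance_prob
  by (metis ext antisym pair_distance_prob_le mm_isometric_sym)

definition random_mm_space :: "'w measure \<Rightarrow> ('w \<Rightarrow> mm_space) \<Rightarrow> bool" where
  "random_mm_space P X \<longleftrightarrow> prob_space P \<and> X \<in> P \<rightarrow>\<^sub>M ghp_borel"

abbreviation lborel_nonneg :: "real measure" where
  "lborel_nonneg \<equiv> restrict_space lborel {0..}"

text \<open>For Borel B the kernel is measurable in its first argument, so the outer nonnegative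
  integral is the expectation of the kernel at the random space.\<close>

definition achieves :: "'w measure \<Rightarrow> ('w \<Rightarrow> mm_space) \<Rightarrow> real measure \<Rightarrow> bool" where
  "achieves P X \<theta> \<longleftrightarrow>
     (\<forall>B\<in>sets (restrict_space borel {0..}).
        emeasure \<theta> B = (\<integral>\<^sup>+\<omega>. distance_kernel (X \<omega>) B \<partial>P))"

end

theory Submission
  imports Defs
begin

text \<open>The random space is the set of leaves of the infinite binary tree, with fair coin tosses as its
  measure and with random radii: two leaves that separate at level k are at distance \<open>r k\<close>, where
  \<open>r 0 \<ge> r 1 \<ge> ...\<close> decreases to 0. This is a compact ultrametric space. Two independent leaves
  separate at level k with probability \<open>1 / 2 ^ Suc k\<close>, so given the radii their distance
  equals \<open>r k\<close> with that probability.

  It remains to choose the radii so that the mixture of their laws, with weights \<open>1 / 2 ^ Suc k\<close>, is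
  the prescribed law. For this the law is cut at its quantiles of the orders \<open>1 / 2 ^ k\<close>: if u is
  uniform on the unit interval and Q is the quantile function, then \<open>r k = Q ((1 + u) / 2 ^ Suc k)\<close>
  has the prescribed law conditioned to a piece of mass \<open>1 / 2 ^ Suc k\<close>, and the pieces recombine to
  the whole. Radii are positive because a density gives no mass to 0, and they tend to 0 because the
  density is positive near 0, so that Q tends to 0 at 0. The construction works for every law on
  the half-line with these two properties (\<open>achieves_of_mass_near_zero\<close>).

  The remaining issue is measurability of the random space. The class of the tree depends
  continuously on the radii (\<open>ghp_dist_cantor_space_le\<close>), and the radii are monotone in u, hence
  continuous up to countably many jumps. To exploit this one needs that the
  Gromov-Hausdorff-Prokhorov distance is a metric (\<open>Metric_space_ghp_dist\<close>). Instead of common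
  spaces the proof works with cross distances, that is, with the distances between the points of the
  two spaces inside a common one: they compose, which gives the triangle inequality, and they form a
  compact set of functions, which shows that spaces at distance 0 are isometric.\<close>

section \<open>Cross distances\<close>

text \<open>A cross distance prescribes the distances between points of two spaces in their disjoint union.
  The four inequalities are the triangle inequalities that involve both spaces. Points at cross
  distance 0 are allowed, so that the identification of two isometric spaces is itself a cross
  distance; this makes the set of cross distances closed under pointwise limits.\<close>

definition cross_distance :: "'a metric \<Rightarrow> 'b metric \<Rightarrow> ('a \<Rightarrow> 'b \<Rightarrow> real) \<Rightarrow> bool" where
  "cross_distance m1 m2 \<rho> \<longleftrightarrow>
     (\<forall>x\<in>mspace m1. \<forall>x'\<in>mspace m1. \<forall>y\<in>mspace m2. \<forall>y'\<in>mspace m2.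
        \<rho> x y \<le> mdist m1 x x' + \<rho> x' y \<and>
        \<rho> x y \<le> \<rho> x y' + mdist m2 y' y \<and>
        mdist m1 x x' \<le> \<rho> x y + \<rho> x' y \<and>
        mdist m2 y y' \<le> \<rho> x y + \<rho> x y')"

definition cross_nbhd :: "'b metric \<Rightarrow> ('a \<Rightarrow> 'b \<Rightarrow> real) \<Rightarrow> real \<Rightarrow> 'a set \<Rightarrow> 'b set" where
  "cross_nbhd m2 \<rho> \<epsilon> A = {y \<in> mspace m2. \<exists>x\<in>A. \<rho> x y < \<epsilon>}"

text \<open>One of the two symmetric halves of ``Hausdorff and Prokhorov distance below \<epsilon> in the glued
  space''. Splitting it off means that each estimate is proved once and then used in both
  directions.\<close>

definition half_close :: "real \<Rightarrow> ('a \<Rightarrow> 'b \<Rightarrow> real) \<Rightarrow> 'a metric \<times> 'a measure \<Rightarrow> 'b metric \<times> 'b measure \<Rightarrow> bool" where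
  "half_close \<epsilon> \<rho> = (\<lambda>(m1, \<mu>1) (m2, \<mu>2).
     (\<forall>x\<in>mspace m1. \<exists>y\<in>mspace m2. \<rho> x y < \<epsilon>) \<and>
     (\<forall>A\<in>sets \<mu>1. measure \<mu>1 A \<le> measure \<mu>2 (cross_nbhd m2 \<rho> \<epsilon> A) + \<epsilon>))"

definition close_along :: "real \<Rightarrow> ('a \<Rightarrow> 'b \<Rightarrow> real) \<Rightarrow> 'a metric \<times> 'a measure \<Rightarrow> 'b metric \<times> 'b measure \<Rightarrow> bool" where
  "close_along \<epsilon> \<rho> X Y \<longleftrightarrow> cross_distance (fst X) (fst Y) \<rho> \<and>
     half_close \<epsilon> \<rho> X Y \<and> half_close \<epsilon> (\<lambda>y x. \<rho> x y) Y X"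

lemma cross_distanceD:
  assumes "cross_distance m1 m2 \<rho>" "x \<in> mspace m1" "y \<in> mspace m2"
  shows "x' \<in> mspace m1 \<Longrightarrow> \<rho> x y \<le> mdist m1 x x' + \<rho> x' y"
    and "y' \<in> mspace m2 \<Longrightarrow> \<rho> x y \<le> \<rho> x y' + mdist m2 y' y"
    and "x' \<in> mspace m1 \<Longrightarrow> mdist m1 x x' \<le> \<rho> x y + \<rho> x' y"
    and "y' \<in> mspace m2 \<Longrightarrow> mdist m2 y y' \<le> \<rho> x y + \<rho> x y'"
    and "0 \<le> \<rho> x y"
proof -
  show "x' \<in> mspace m1 \<Longrightarrow> \<rho> x y \<le> mdist m1 x x' + \<rho> x' y"
    and "y' \<in> mspace m2 \<Longrightarrow> \<rho> x y \<le> \<rho> x y' + mdist m2 y' y"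
    and *: "x' \<in> mspace m1 \<Longrightarrow> mdist m1 x x' \<le> \<rho> x y + \<rho> x' y"
    and "y' \<in> mspace m2 \<Longrightarrow> mdist m2 y y' \<le> \<rho> x y + \<rho> x y'" for x'
    using assms unfolding cross_distance_def by blast+
  show "0 \<le> \<rho> x y"
    using *[of x] mdist_nonneg[of m1 x x] assms(2) by linarith
qed

lemma cross_distance_flip:
  assumes "cross_distance m1 m2 \<rho>" shows "cross_distance m2 m1 (\<lambda>y x. \<rho> x y)"
  unfolding cross_distance_def
proof (intro ballI conjI)
  fix y y' x x' assume *: "y \<in> mspace m2" "y' \<in> mspace m2" "x \<in> mspace m1" "x' \<in> mspace m1"
  note cd = cross_distanceD[OF assms *(3)]
  show "\<rho> x y \<le> mdist m2 y y' + \<rho> x y'"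
    using cd(2)[OF *(1,2)] by (simp add: mdist_commute add.commute)
  show "\<rho> x y \<le> \<rho> x' y + mdist m1 x' x"
    using cd(1)[OF *(1,4)] by (simp add: mdist_commute add.commute)
  show "mdist m2 y y' \<le> \<rho> x y + \<rho> x y'" by (rule cd(4)[OF *(1,2)])
  show "mdist m1 x x' \<le> \<rho> x y + \<rho> x' y" by (rule cd(3)[OF *(1,4)])
qed

lemma close_along_flip: "close_along \<epsilon> \<rho> X Y \<Longrightarrow> close_along \<epsilon> (\<lambda>y x. \<rho> x y) Y X"
  unfolding close_along_def by (auto intro: cross_distance_flip)

lemma close_alongD:
  assumes "close_along \<epsilon> \<rho> (m1, \<mu>1) (m2, \<mu>2)"
  shows "cross_distance m1 m2 \<rho>" "half_close \<epsilon> \<rho> (m1, \<mu>1) (m2, \<mu>2)"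
    "half_close \<epsilon> (\<lambda>y x. \<rho> x y) (m2, \<mu>2) (m1, \<mu>1)"
  using assms by (simp_all add: close_along_def)

lemma half_closeD:
  assumes "half_close \<epsilon> \<rho> (m1, \<mu>1) (m2, \<mu>2)"
  shows "x \<in> mspace m1 \<Longrightarrow> \<exists>y\<in>mspace m2. \<rho> x y < \<epsilon>"
    and "A \<in> sets \<mu>1 \<Longrightarrow> measure \<mu>1 A \<le> measure \<mu>2 (cross_nbhd m2 \<rho> \<epsilon> A) + \<epsilon>"
  using assms by (simp_all add: half_close_def)

lemma mdist_self: "x \<in> mspace m \<Longrightarrow> mdist m x x = 0"
  by simp

lemma openin_mtopology_of:
  "openin (mtopology_of m) U \<longleftrightarrow>
     U \<subseteq> mspace m \<and> (\<forall>x\<in>U. \<exists>r>0. \<forall>y\<in>mspace m. mdist m x y < r \<longrightarrow> y \<in> U)"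
proof -
  interpret Metric_space "mspace m" "mdist m" by simp
  show ?thesis
    unfolding mtopology_of_def openin_mtopology subset_iff in_mball Ball_def by blast
qed

lemma openin_metric_borel: "openin (mtopology_of m) U \<Longrightarrow> U \<in> sets (metric_borel m)"
  by (simp add: sets_metric_borel)

text \<open>Neighbourhoods are open whatever the set A is. This makes them measurable, which is why arbitrary
  Borel sets can be transported from one space to another by passing to a neighbourhood: images of
  Borel sets never have to be measured.\<close>

lemma openin_cross_nbhd:
  assumes "cross_distance m1 m2 \<rho>" "A \<subseteq> mspace m1"
  shows "openin (mtopology_of m2) (cross_nbhd m2 \<rho> \<epsilon> A)"
  unfolding openin_mtopology_of
proof (intro conjI ballI)
  show "cross_nbhd m2 \<rho> \<epsilon> A \<subseteq> mspace m2" by (auto simp: cross_nbhd_def)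
  fix y assume "y \<in> cross_nbhd m2 \<rho> \<epsilon> A"
  then obtain x where x: "x \<in> A" "\<rho> x y < \<epsilon>" "y \<in> mspace m2" by (auto simp: cross_nbhd_def)
  show "\<exists>r>0. \<forall>z\<in>mspace m2. mdist m2 y z < r \<longrightarrow> z \<in> cross_nbhd m2 \<rho> \<epsilon> A"
  proof (intro exI[of _ "\<epsilon> - \<rho> x y"] conjI ballI impI)
    fix z assume z: "z \<in> mspace m2" "mdist m2 y z < \<epsilon> - \<rho> x y"
    then have "\<rho> x z \<le> \<rho> x y + mdist m2 y z"
      using cross_distanceD(2)[OF assms(1)] x assms(2) by blast
    with z x show "z \<in> cross_nbhd m2 \<rho> \<epsilon> A" by (force simp: cross_nbhd_def)
  qed (use x in simp)
qed

lemma metric_nbhd_eq_cross_nbhd: "metric_nbhd m \<epsilon> A = cross_nbhd m (mdist m) \<epsilon> A"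
  by (auto simp: metric_nbhd_def cross_nbhd_def)

lemma cross_distance_mdist: "cross_distance m m (mdist m)"
  unfolding cross_distance_def
proof (intro ballI conjI)
  fix x x' y y' assume *: "x \<in> mspace m" "x' \<in> mspace m" "y \<in> mspace m" "y' \<in> mspace m"
  show "mdist m x y \<le> mdist m x x' + mdist m x' y" "mdist m x y \<le> mdist m x y' + mdist m y' y"
    using * by (auto intro: mdist_triangle)
  show "mdist m x x' \<le> mdist m x y + mdist m x' y"
    using * mdist_triangle[of x m y x'] by (simp add: mdist_commute[of m])
  show "mdist m y y' \<le> mdist m x y + mdist m x y'"
    using * mdist_triangle[of y m x y'] by (simp add: mdist_commute[of m])
qed

lemma cross_distance_embeddings:
  assumes "isometric_embedding m1 m \<phi>1" "isometric_embedding m2 m \<phi>2"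
  shows "cross_distance m1 m2 (\<lambda>x y. mdist m (\<phi>1 x) (\<phi>2 y))"
  unfolding cross_distance_def
proof (intro ballI)
  fix x x' y y' assume *: "x \<in> mspace m1" "x' \<in> mspace m1" "y \<in> mspace m2" "y' \<in> mspace m2"
  then have in_m: "\<phi>1 x \<in> mspace m" "\<phi>1 x' \<in> mspace m" "\<phi>2 y \<in> mspace m" "\<phi>2 y' \<in> mspace m"
    using assms by (auto simp: isometric_embedding_def)
  have eq: "mdist m (\<phi>1 x) (\<phi>1 x') = mdist m1 x x'" "mdist m (\<phi>2 y') (\<phi>2 y) = mdist m2 y' y"
    "mdist m (\<phi>2 y) (\<phi>2 y') = mdist m2 y y'"
    using assms * by (simp_all add: isometric_embedding_def)
  show "mdist m (\<phi>1 x) (\<phi>2 y) \<le> mdist m1 x x' + mdist m (\<phi>1 x') (\<phi>2 y) \<and>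
      mdist m (\<phi>1 x) (\<phi>2 y) \<le> mdist m (\<phi>1 x) (\<phi>2 y') + mdist m2 y' y \<and>
      mdist m1 x x' \<le> mdist m (\<phi>1 x) (\<phi>2 y) + mdist m (\<phi>1 x') (\<phi>2 y) \<and>
      mdist m2 y y' \<le> mdist m (\<phi>1 x) (\<phi>2 y) + mdist m (\<phi>1 x) (\<phi>2 y')"
    unfolding eq[symmetric]
    using cross_distanceD(1-4)[OF cross_distance_mdist in_m(1,3)] in_m by blast
qed

lemma openin_metric_nbhd:
  "A \<subseteq> mspace m \<Longrightarrow> openin (mtopology_of m) (metric_nbhd m \<epsilon> A)"
  unfolding metric_nbhd_eq_cross_nbhd by (rule openin_cross_nbhd[OF cross_distance_mdist])

text \<open>A positive cross distance makes the disjoint union a metric space. Since the common space has to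
  carry real labels, the two copies are kept apart by sign: the exponential function sends the first
  space to positive labels, its negative the second space to negative ones.\<close>

lemma glued_metric_exists:
  fixes m1 m2 :: "real metric"
  assumes "cross_distance m1 m2 \<rho>"
    and pos: "\<And>x y. x \<in> mspace m1 \<Longrightarrow> y \<in> mspace m2 \<Longrightarrow> 0 < \<rho> x y"
  obtains m :: "real metric" and \<phi>1 \<phi>2
  where "isometric_embedding m1 m \<phi>1" "isometric_embedding m2 m \<phi>2"
    "\<And>x y. x \<in> mspace m1 \<Longrightarrow> y \<in> mspace m2 \<Longrightarrow> mdist m (\<phi>1 x) (\<phi>2 y) = \<rho> x y"
proof -
  define e1 :: "real \<Rightarrow> real" where "e1 = exp"
  define e2 :: "real \<Rightarrow> real" where "e2 = (\<lambda>x. - exp x)"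
  define M where "M = e1 ` mspace m1 \<union> e2 ` mspace m2"
  define D where "D = (\<lambda>z w. if z \<in> M \<and> w \<in> M then
      (if z > 0 then if w > 0 then mdist m1 (ln z) (ln w) else \<rho> (ln z) (ln (-w))
       else if w > 0 then \<rho> (ln w) (ln (-z)) else mdist m2 (ln (-z)) (ln (-w)))
     else 0)"
  have D11: "D (e1 x) (e1 x') = mdist m1 x x'" if "x \<in> mspace m1" "x' \<in> mspace m1" for x x'
    using that by (auto simp: D_def M_def e1_def e2_def)
  have D22: "D (e2 x) (e2 x') = mdist m2 x x'" if "x \<in> mspace m2" "x' \<in> mspace m2" for x x'
    using that by (auto simp: D_def M_def e1_def e2_def)
  have D12: "D (e1 x) (e2 y) = \<rho> x y" "D (e2 y) (e1 x) = \<rho> x y"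
    if "x \<in> mspace m1" "y \<in> mspace m2" for x y
    using that by (auto simp: D_def M_def e1_def e2_def)
  have cases_M: "(\<exists>x\<in>mspace m1. z = e1 x) \<or> (\<exists>y\<in>mspace m2. z = e2 y)" if "z \<in> M" for z
    using that by (auto simp: M_def)
  have e12: "e1 x \<noteq> e2 y" for x y
    using exp_gt_zero[of x] exp_gt_zero[of y] unfolding e1_def e2_def by linarith
  have inj: "e1 x = e1 x' \<longleftrightarrow> x = x'" "e2 x = e2 x' \<longleftrightarrow> x = x'" for x x'
    by (auto simp: e1_def e2_def)
  note cd = cross_distanceD[OF assms(1)]
  have "Metric_space M D"
  proof
    fix z w
    show "0 \<le> D z w"
    proof (cases "z \<in> M \<and> w \<in> M")
      case True
      with cases_M[of z] cases_M[of w] cd(5) show ?thesis by (auto simp: D11 D12 D22)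
    next
      case False
      then show ?thesis by (auto simp: D_def)
    qed
    show "D z w = D w z"
    proof (cases "z \<in> M \<and> w \<in> M")
      case True
      with cases_M[of z] cases_M[of w] show ?thesis by (auto simp: D11 D12 D22 mdist_commute)
    next
      case False
      then show ?thesis by (auto simp: D_def)
    qed
  next
    fix z w assume "z \<in> M" "w \<in> M"
    then consider
        x x' where "z = e1 x" "w = e1 x'" "{x, x'} \<subseteq> mspace m1"
      | x y where "z = e1 x" "w = e2 y" "x \<in> mspace m1" "y \<in> mspace m2"
      | x y where "z = e2 y" "w = e1 x" "x \<in> mspace m1" "y \<in> mspace m2"
      | y y' where "z = e2 y" "w = e2 y'" "{y, y'} \<subseteq> mspace m2"
      using cases_M[of z] cases_M[of w] by auto
    then show "D z w = 0 \<longleftrightarrow> z = w"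
    proof cases
      case (2 x y)
      with pos[of x y] e12[of x y] show ?thesis by (simp add: D12)
    next
      case (3 x y)
      with pos[of x y] e12[of x y] show ?thesis by (simp add: D12)
    qed (simp_all add: D11 D22 inj)
  next
    fix z w v assume "z \<in> M" "w \<in> M" "v \<in> M"
    then consider
        x x' x'' where "z = e1 x" "w = e1 x'" "v = e1 x''" "{x, x', x''} \<subseteq> mspace m1"
      | x x' y where "z = e1 x" "w = e1 x'" "v = e2 y" "{x, x'} \<subseteq> mspace m1" "y \<in> mspace m2"
      | x y x' where "z = e1 x" "w = e2 y" "v = e1 x'" "{x, x'} \<subseteq> mspace m1" "y \<in> mspace m2"
      | x y y' where "z = e1 x" "w = e2 y" "v = e2 y'" "x \<in> mspace m1" "{y, y'} \<subseteq> mspace m2"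
      | y x x' where "z = e2 y" "w = e1 x" "v = e1 x'" "{x, x'} \<subseteq> mspace m1" "y \<in> mspace m2"
      | y x y' where "z = e2 y" "w = e1 x" "v = e2 y'" "x \<in> mspace m1" "{y, y'} \<subseteq> mspace m2"
      | y y' x where "z = e2 y" "w = e2 y'" "v = e1 x" "x \<in> mspace m1" "{y, y'} \<subseteq> mspace m2"
      | y y' y'' where "z = e2 y" "w = e2 y'" "v = e2 y''" "{y, y', y''} \<subseteq> mspace m2"
      using cases_M[of z] cases_M[of w] cases_M[of v] by auto
    then show "D z v \<le> D z w + D w v"
    proof cases
      case (1 x x' x'')
      then show ?thesis using mdist_triangle[of x m1 x' x''] by (simp add: D11)
    next
      case (2 x x' y)
      then show ?thesis using cd(1)[of x y x'] by (simp add: D11 D12)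
    next
      case (3 x y x')
      then show ?thesis using cd(3)[of x y x'] by (simp add: D11 D12)
    next
      case (4 x y y')
      then show ?thesis using cd(2)[of x y' y] by (simp add: D22 D12)
    next
      case (5 y x x')
      then show ?thesis using cd(1)[of x' y x] by (simp add: D11 D12 mdist_commute)
    next
      case (6 y x y')
      then show ?thesis using cd(4)[of x y y'] by (simp add: D22 D12)
    next
      case (7 y y' x)
      then show ?thesis using cd(2)[of x y y'] by (simp add: D22 D12 mdist_commute)
    next
      case (8 y y' y'')
      then show ?thesis using mdist_triangle[of y m2 y' y''] by (simp add: D22)
    qed
  qed
  then interpret Metric_space M D .
  show thesis
  proof (rule that[of "metric (M, D)" e1 e2])
    show "isometric_embedding m1 (metric (M, D)) e1" "isometric_embedding m2 (metric (M, D)) e2"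
      by (auto simp: isometric_embedding_def D11 D22) (auto simp: M_def)
  qed (simp add: D12)
qed

section \<open>Closeness along a cross distance and the Gromov-Hausdorff-Prokhorov distance\<close>

lemma compact_mm_spaceD:
  assumes "compact_mm_space (m, \<mu>)"
  shows "prob_space \<mu>" "space \<mu> = mspace m" "sets \<mu> = sets (metric_borel m)" "mspace m \<noteq> {}"
    "compact_space (mtopology_of m)"
  using assms prob_space.not_empty[of \<mu>] by (auto simp: compact_mm_space_def)

lemma compact_mm_space_bounded:
  assumes "compact_mm_space (m, \<mu>)"
  obtains K where "\<And>x y. x \<in> mspace m \<Longrightarrow> y \<in> mspace m \<Longrightarrow> mdist m x y \<le> K"
proof -
  interpret Metric_space "mspace m" "mdist m" by simp
  have "compactin mtopology (mspace m)"
    using compact_mm_spaceD(5)[OF assms] by (simp add: compact_space_def mtopology_of_def)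
  then have "mbounded (mspace m)" by (rule compactin_imp_mbounded)
  then show thesis
    unfolding mbounded_alt using that by blast
qed

lemma prob_space_distr_embedding:
  assumes "compact_mm_space (m1, \<mu>1)" "isometric_embedding m1 m \<phi>"
  shows "prob_space (distr \<mu>1 (metric_borel m) \<phi>)"
  by (rule prob_space.prob_space_distr[OF compact_mm_spaceD(1)[OF assms(1)]
        mm_isometric_measurable[OF assms]])

text \<open>Two embeddings into a common space induce a cross distance by restriction. A Borel set A of the
  first space is replaced by an open neighbourhood of its image, of radius \<open>\<epsilon> - \<delta>\<close>, before the
  Prokhorov inequality at level \<delta> is applied; the two radii add up to \<epsilon>.\<close>

lemma half_close_of_embeddings:
  assumes c1: "compact_mm_space (m1, \<mu>1)" and c2: "compact_mm_space (m2, \<mu>2)"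
    and iso1: "isometric_embedding m1 m \<phi>1" and iso2: "isometric_embedding m2 m \<phi>2"
    and hd: "(SUP a\<in>\<phi>1 ` mspace m1. INF b\<in>\<phi>2 ` mspace m2. mdist m a b) < \<epsilon>"
    and \<delta>: "\<delta> < \<epsilon>"
    and prok: "\<And>A. A \<in> sets (metric_borel m) \<Longrightarrow>
       measure (distr \<mu>1 (metric_borel m) \<phi>1) A
         \<le> measure (distr \<mu>2 (metric_borel m) \<phi>2) (metric_nbhd m \<delta> A) + \<delta>"
  shows "half_close \<epsilon> (\<lambda>x y. mdist m (\<phi>1 x) (\<phi>2 y)) (m1, \<mu>1) (m2, \<mu>2)"
  unfolding half_close_def prod.case
proof (intro conjI ballI)
  note s1 = compact_mm_spaceD[OF c1] and s2 = compact_mm_spaceD[OF c2]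
  have in1: "\<phi>1 x \<in> mspace m" if "x \<in> mspace m1" for x
    using iso1 that by (auto simp: isometric_embedding_def)
  have in2: "\<phi>2 x \<in> mspace m" if "x \<in> mspace m2" for x
    using iso2 that by (auto simp: isometric_embedding_def)
  {
    fix x assume x: "x \<in> mspace m1"
    obtain K where K: "\<And>x y. x \<in> mspace m1 \<Longrightarrow> y \<in> mspace m1 \<Longrightarrow> mdist m1 x y \<le> K"
      using compact_mm_space_bounded[OF c1] by blast
    obtain y0 where y0: "y0 \<in> mspace m2" using s2(4) by blast
    have bb: "bdd_below (mdist m a ` \<phi>2 ` mspace m2)" for a
      by (rule bdd_belowI[of _ 0]) auto
    have "(INF b\<in>\<phi>2 ` mspace m2. mdist m a b) \<le> K + mdist m (\<phi>1 x) (\<phi>2 y0)"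
      if "a \<in> \<phi>1 ` mspace m1" for a
    proof -
      from that obtain x' where x': "x' \<in> mspace m1" "a = \<phi>1 x'" by blast
      have "(INF b\<in>\<phi>2 ` mspace m2. mdist m a b) \<le> mdist m (\<phi>1 x') (\<phi>2 y0)"
        using x' y0 by (intro cINF_lower[OF bb, THEN order_trans]) auto
      also have "\<dots> \<le> mdist m (\<phi>1 x') (\<phi>1 x) + mdist m (\<phi>1 x) (\<phi>2 y0)"
        using x x' y0 by (intro mdist_triangle in1 in2)
      also have "mdist m (\<phi>1 x') (\<phi>1 x) \<le> K"
        using iso1 x x' K by (simp add: isometric_embedding_def)
      finally show ?thesis by simp
    qed
    then have "bdd_above ((\<lambda>a. INF b\<in>\<phi>2 ` mspace m2. mdist m a b) ` \<phi>1 ` mspace m1)"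
      by (intro bdd_aboveI) blast
    then have "(INF b\<in>\<phi>2 ` mspace m2. mdist m (\<phi>1 x) b) < \<epsilon>"
      using cSUP_upper[of "\<phi>1 x" "\<phi>1 ` mspace m1" "\<lambda>a. INF b\<in>\<phi>2 ` mspace m2. mdist m a b"] x hd
      by force
    then show "\<exists>y\<in>mspace m2. mdist m (\<phi>1 x) (\<phi>2 y) < \<epsilon>"
      using s2(4) by (subst (asm) cINF_less_iff[OF _ bb]) auto
  next
    fix A assume A: "A \<in> sets \<mu>1"
    interpret p1: prob_space \<mu>1 by (rule s1)
    interpret p2: prob_space \<mu>2 by (rule s2)
    have A': "A \<subseteq> mspace m1" using sets.sets_into_space[OF A] s1 by simp
    have mb1: "\<phi>1 \<in> \<mu>1 \<rightarrow>\<^sub>M metric_borel m" by (rule mm_isometric_measurable[OF c1 iso1])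
    have mb2: "\<phi>2 \<in> \<mu>2 \<rightarrow>\<^sub>M metric_borel m" by (rule mm_isometric_measurable[OF c2 iso2])
    define U where "U = metric_nbhd m (\<epsilon> - \<delta>) (\<phi>1 ` A)"
    define V where "V = metric_nbhd m \<delta> U"
    have "openin (mtopology_of m) U"
      unfolding U_def using A' in1 by (intro openin_metric_nbhd) auto
    then have U: "U \<in> sets (metric_borel m)" by (rule openin_metric_borel)
    have "U \<subseteq> mspace m" unfolding U_def metric_nbhd_def by auto
    then have "openin (mtopology_of m) V"
      unfolding V_def by (rule openin_metric_nbhd)
    then have V: "V \<in> sets (metric_borel m)" by (rule openin_metric_borel)
    have cross: "cross_distance m1 m2 (\<lambda>x y. mdist m (\<phi>1 x) (\<phi>2 y))"
      by (rule cross_distance_embeddings[OF iso1 iso2])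
    have W: "cross_nbhd m2 (\<lambda>x y. mdist m (\<phi>1 x) (\<phi>2 y)) \<epsilon> A \<in> sets \<mu>2"
      unfolding s2(3) by (rule openin_metric_borel[OF openin_cross_nbhd[OF cross A']])
    have "A \<subseteq> \<phi>1 -` U \<inter> space \<mu>1"
    proof
      fix x assume "x \<in> A"
      moreover have "mdist m (\<phi>1 x) (\<phi>1 x) = 0" using A' in1 \<open>x \<in> A\<close> by auto
      ultimately show "x \<in> \<phi>1 -` U \<inter> space \<mu>1"
        using A' in1 \<delta> s1(2) unfolding U_def metric_nbhd_def
        by (auto intro!: bexI[of _ x])
    qed
    then have "measure \<mu>1 A \<le> measure \<mu>1 (\<phi>1 -` U \<inter> space \<mu>1)"
      using measurable_sets[OF mb1 U] by (rule p1.finite_measure_mono)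
    also have "\<dots> = measure (distr \<mu>1 (metric_borel m) \<phi>1) U"
      by (rule measure_distr[OF mb1 U, symmetric])
    also have "\<dots> \<le> measure (distr \<mu>2 (metric_borel m) \<phi>2) V + \<delta>"
      unfolding V_def by (rule prok[OF U])
    also have "measure (distr \<mu>2 (metric_borel m) \<phi>2) V = measure \<mu>2 (\<phi>2 -` V \<inter> space \<mu>2)"
      by (rule measure_distr[OF mb2 V])
    also have "\<dots> \<le> measure \<mu>2 (cross_nbhd m2 (\<lambda>x y. mdist m (\<phi>1 x) (\<phi>2 y)) \<epsilon> A)"
    proof (rule p2.finite_measure_mono[OF _ W], rule subsetI)
      fix y assume y: "y \<in> \<phi>2 -` V \<inter> space \<mu>2"
      then obtain u x where *: "u \<in> mspace m" "mdist m u (\<phi>2 y) < \<delta>" "x \<in> A"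
        "mdist m (\<phi>1 x) u < \<epsilon> - \<delta>" "y \<in> mspace m2"
        using s2(2) unfolding V_def U_def metric_nbhd_def by auto
      then have "mdist m (\<phi>1 x) (\<phi>2 y) < \<epsilon>"
        using mdist_triangle[of "\<phi>1 x" m u "\<phi>2 y"] in1 in2 A' by force
      then show "y \<in> cross_nbhd m2 (\<lambda>x y. mdist m (\<phi>1 x) (\<phi>2 y)) \<epsilon> A"
        using * by (auto simp: cross_nbhd_def)
    qed
    finally show "measure \<mu>1 A
        \<le> measure \<mu>2 (cross_nbhd m2 (\<lambda>x y. mdist m (\<phi>1 x) (\<phi>2 y)) \<epsilon> A) + \<epsilon>"
      using \<delta> by simp
  }
qed

lemma
  assumes "prob_space \<mu>" "prob_space \<nu>"
  shows prokhorov_dist_nonneg: "0 \<le> prokhorov_dist m \<mu> \<nu>"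
    and prokhorov_dist_lessD: "prokhorov_dist m \<mu> \<nu> < \<epsilon> \<Longrightarrow> \<exists>\<delta>. 0 < \<delta> \<and> \<delta> < \<epsilon> \<and>
       (\<forall>A\<in>sets (metric_borel m).
          measure \<mu> A \<le> measure \<nu> (metric_nbhd m \<delta> A) + \<delta> \<and>
          measure \<nu> A \<le> measure \<mu> (metric_nbhd m \<delta> A) + \<delta>)"
proof -
  let ?S = "{\<epsilon>. 0 < \<epsilon> \<and> (\<forall>A\<in>sets (metric_borel m).
       measure \<mu> A \<le> measure \<nu> (metric_nbhd m \<epsilon> A) + \<epsilon> \<and>
       measure \<nu> A \<le> measure \<mu> (metric_nbhd m \<epsilon> A) + \<epsilon>)}"
  have "1 \<in> ?S"
    using prob_space.prob_le_1[OF assms(1)] prob_space.prob_le_1[OF assms(2)]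
    by (auto intro!: order_trans[OF _ add_increasing[OF measure_nonneg order_refl]])
  then have ne: "?S \<noteq> {}" by blast
  show "0 \<le> prokhorov_dist m \<mu> \<nu>"
    unfolding prokhorov_dist_def by (rule cInf_greatest[OF ne]) auto
  assume "prokhorov_dist m \<mu> \<nu> < \<epsilon>"
  then show "\<exists>\<delta>. 0 < \<delta> \<and> \<delta> < \<epsilon> \<and> (\<forall>A\<in>sets (metric_borel m).
       measure \<mu> A \<le> measure \<nu> (metric_nbhd m \<delta> A) + \<delta> \<and>
       measure \<nu> A \<le> measure \<mu> (metric_nbhd m \<delta> A) + \<delta>)"
    unfolding prokhorov_dist_def using cInf_lessD[OF ne] by blast
qed

lemma close_along_of_ghp_value:
  assumes c1: "compact_mm_space (m1, \<mu>1)" and c2: "compact_mm_space (m2, \<mu>2)"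
    and v: "v \<in> ghp_values (m1, \<mu>1) (m2, \<mu>2)" "v < \<epsilon>"
  obtains \<rho> where "close_along \<epsilon> \<rho> (m1, \<mu>1) (m2, \<mu>2)"
proof -
  from v obtain m :: "real metric" and \<phi>1 \<phi>2 where
    iso1: "isometric_embedding m1 m \<phi>1" and iso2: "isometric_embedding m2 m \<phi>2" and
    hd: "hausdorff_dist m (\<phi>1 ` mspace m1) (\<phi>2 ` mspace m2) < \<epsilon>" and
    pd: "prokhorov_dist m (distr \<mu>1 (metric_borel m) \<phi>1) (distr \<mu>2 (metric_borel m) \<phi>2) < \<epsilon>"
    by (auto simp: ghp_values_def)
  note ps = prob_space_distr_embedding[OF c1 iso1] prob_space_distr_embedding[OF c2 iso2]
  from prokhorov_dist_lessD[OF ps pd] obtain \<delta> where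
    \<delta>: "\<delta> < \<epsilon>" and pr:
     "\<And>A. A \<in> sets (metric_borel m) \<Longrightarrow>
       measure (distr \<mu>1 (metric_borel m) \<phi>1) A
         \<le> measure (distr \<mu>2 (metric_borel m) \<phi>2) (metric_nbhd m \<delta> A) + \<delta>"
     "\<And>A. A \<in> sets (metric_borel m) \<Longrightarrow>
       measure (distr \<mu>2 (metric_borel m) \<phi>2) A
         \<le> measure (distr \<mu>1 (metric_borel m) \<phi>1) (metric_nbhd m \<delta> A) + \<delta>"
    by blast
  define \<rho> where "\<rho> = (\<lambda>x y. mdist m (\<phi>1 x) (\<phi>2 y))"
  have "half_close \<epsilon> \<rho> (m1, \<mu>1) (m2, \<mu>2)"
    unfolding \<rho>_def using hd
    by (intro half_close_of_embeddings[OF c1 c2 iso1 iso2 _ \<delta> pr(1)]) (auto simp: hausdorff_dist_def)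
  moreover have "half_close \<epsilon> (\<lambda>y x. mdist m (\<phi>2 y) (\<phi>1 x)) (m2, \<mu>2) (m1, \<mu>1)"
    using hd
    by (intro half_close_of_embeddings[OF c2 c1 iso2 iso1 _ \<delta> pr(2)])
       (auto simp: hausdorff_dist_def mdist_commute)
  moreover have "(\<lambda>y x. mdist m (\<phi>2 y) (\<phi>1 x)) = (\<lambda>y x. \<rho> x y)"
    by (simp add: \<rho>_def mdist_commute)
  moreover have "cross_distance m1 m2 \<rho>"
    unfolding \<rho>_def by (rule cross_distance_embeddings[OF iso1 iso2])
  ultimately show thesis
    using that by (simp add: close_along_def)
qed

lemma ghp_values_nonneg:
  assumes c1: "compact_mm_space (m1, \<mu>1)" and c2: "compact_mm_space (m2, \<mu>2)"
    and v: "v \<in> ghp_values (m1, \<mu>1) (m2, \<mu>2)"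
  shows "0 \<le> v"
proof -
  from v obtain m :: "real metric" and \<phi>1 \<phi>2 where
    iso1: "isometric_embedding m1 m \<phi>1" and iso2: "isometric_embedding m2 m \<phi>2" and
    v: "v = max (hausdorff_dist m (\<phi>1 ` mspace m1) (\<phi>2 ` mspace m2))
      (prokhorov_dist m (distr \<mu>1 (metric_borel m) \<phi>1) (distr \<mu>2 (metric_borel m) \<phi>2))"
    by (auto simp: ghp_values_def)
  note ps = prob_space_distr_embedding[OF c1 iso1] prob_space_distr_embedding[OF c2 iso2]
  show ?thesis using prokhorov_dist_nonneg[OF ps] by (simp add: v le_max_iff_disj)
qed

text \<open>The shift by \<delta> in the hypothesis on the common metric is the room that turns a cross distance
  into a positive one, so that the glued space exists.\<close>

lemma half_close_imp_prokhorov: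
  assumes c1: "compact_mm_space (m1, \<mu>1)" and c2: "compact_mm_space (m2, \<mu>2)"
    and iso1: "isometric_embedding m1 m \<phi>1" and iso2: "isometric_embedding m2 m \<phi>2"
    and hc: "half_close \<epsilon> \<rho> (m1, \<mu>1) (m2, \<mu>2)"
    and \<rho>: "\<And>x y. x \<in> mspace m1 \<Longrightarrow> y \<in> mspace m2 \<Longrightarrow> mdist m (\<phi>1 x) (\<phi>2 y) = \<rho> x y + \<delta>"
    and A: "A \<in> sets (metric_borel m)"
  shows "measure (distr \<mu>1 (metric_borel m) \<phi>1) A
           \<le> measure (distr \<mu>2 (metric_borel m) \<phi>2) (metric_nbhd m (\<epsilon> + \<delta>) A) + \<epsilon>"
proof -
  note s1 = compact_mm_spaceD[OF c1] and s2 = compact_mm_spaceD[OF c2]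
  interpret p2: prob_space \<mu>2 by (rule s2)
  have mb1: "\<phi>1 \<in> \<mu>1 \<rightarrow>\<^sub>M metric_borel m" by (rule mm_isometric_measurable[OF c1 iso1])
  have mb2: "\<phi>2 \<in> \<mu>2 \<rightarrow>\<^sub>M metric_borel m" by (rule mm_isometric_measurable[OF c2 iso2])
  have "A \<subseteq> mspace m" using sets.sets_into_space[OF A] by simp
  then have V: "metric_nbhd m (\<epsilon> + \<delta>) A \<in> sets (metric_borel m)"
    by (intro openin_metric_borel openin_metric_nbhd)
  have A1: "\<phi>1 -` A \<inter> space \<mu>1 \<in> sets \<mu>1" by (rule measurable_sets[OF mb1 A])
  have "measure (distr \<mu>1 (metric_borel m) \<phi>1) A = measure \<mu>1 (\<phi>1 -` A \<inter> space \<mu>1)"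
    by (rule measure_distr[OF mb1 A])
  also have "\<dots> \<le> measure \<mu>2 (cross_nbhd m2 \<rho> \<epsilon> (\<phi>1 -` A \<inter> space \<mu>1)) + \<epsilon>"
    using hc A1 by (simp add: half_close_def)
  also have "measure \<mu>2 (cross_nbhd m2 \<rho> \<epsilon> (\<phi>1 -` A \<inter> space \<mu>1))
      \<le> measure \<mu>2 (\<phi>2 -` metric_nbhd m (\<epsilon> + \<delta>) A \<inter> space \<mu>2)"
  proof (rule p2.finite_measure_mono[OF _ measurable_sets[OF mb2 V]], rule subsetI)
    fix y assume "y \<in> cross_nbhd m2 \<rho> \<epsilon> (\<phi>1 -` A \<inter> space \<mu>1)"
    then obtain x where "y \<in> mspace m2" "x \<in> mspace m1" "\<phi>1 x \<in> A" "\<rho> x y < \<epsilon>"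
      using s1(2) by (auto simp: cross_nbhd_def)
    moreover from this have "\<phi>2 y \<in> mspace m" using iso2 by (auto simp: isometric_embedding_def)
    ultimately show "y \<in> \<phi>2 -` metric_nbhd m (\<epsilon> + \<delta>) A \<inter> space \<mu>2"
      using s2(2) \<rho>[of x y] by (auto simp: metric_nbhd_def intro!: bexI[of _ "\<phi>1 x"])
  qed
  also have "\<dots> = measure (distr \<mu>2 (metric_borel m) \<phi>2) (metric_nbhd m (\<epsilon> + \<delta>) A)"
    by (rule measure_distr[OF mb2 V, symmetric])
  finally show ?thesis by simp
qed

lemma ghp_value_of_close_along:
  assumes c1: "compact_mm_space (m1, \<mu>1)" and c2: "compact_mm_space (m2, \<mu>2)"
    and cl: "close_along \<epsilon> \<rho> (m1, \<mu>1) (m2, \<mu>2)" and \<delta>: "0 < \<delta>"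
  shows "\<exists>v\<in>ghp_values (m1, \<mu>1) (m2, \<mu>2). v \<le> \<epsilon> + \<delta>"
proof -
  note s1 = compact_mm_spaceD[OF c1] and s2 = compact_mm_spaceD[OF c2]
  from cl have cross: "cross_distance m1 m2 \<rho>" and h1: "half_close \<epsilon> \<rho> (m1, \<mu>1) (m2, \<mu>2)"
    and h2: "half_close \<epsilon> (\<lambda>y x. \<rho> x y) (m2, \<mu>2) (m1, \<mu>1)"
    by (auto simp: close_along_def)
  note cd = cross_distanceD[OF cross]
  have ex1: "\<exists>y\<in>mspace m2. \<rho> x y < \<epsilon>" if "x \<in> mspace m1" for x
    using h1 that by (auto simp: half_close_def)
  have ex2: "\<exists>x\<in>mspace m1. \<rho> x y < \<epsilon>" if "y \<in> mspace m2" for y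
    using h2 that by (auto simp: half_close_def)
  have \<epsilon>: "0 < \<epsilon>"
    using s1(4) ex1 cd(5) by fastforce
  have "cross_distance m1 m2 (\<lambda>x y. \<rho> x y + \<delta>)"
    using cross \<delta> unfolding cross_distance_def by force
  moreover have "0 < \<rho> x y + \<delta>" if "x \<in> mspace m1" "y \<in> mspace m2" for x y
    using cd(5)[OF that] \<delta> by simp
  ultimately obtain m :: "real metric" and \<phi>1 \<phi>2 where
    iso1: "isometric_embedding m1 m \<phi>1" and iso2: "isometric_embedding m2 m \<phi>2" and
    \<rho>: "\<And>x y. x \<in> mspace m1 \<Longrightarrow> y \<in> mspace m2 \<Longrightarrow> mdist m (\<phi>1 x) (\<phi>2 y) = \<rho> x y + \<delta>"
    using glued_metric_exists[of m1 m2 "\<lambda>x y. \<rho> x y + \<delta>"] by metis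
  have "hausdorff_dist m (\<phi>1 ` mspace m1) (\<phi>2 ` mspace m2) \<le> \<epsilon> + \<delta>"
    unfolding hausdorff_dist_def image_image
  proof (rule max.boundedI; rule cSUP_least)
    show "mspace m1 \<noteq> {}" "mspace m2 \<noteq> {}" by fact+
    fix x assume "x \<in> mspace m1"
    with ex1 obtain y where "y \<in> mspace m2" "\<rho> x y < \<epsilon>" by blast
    with \<open>x \<in> mspace m1\<close> show "(INF y\<in>mspace m2. mdist m (\<phi>1 x) (\<phi>2 y)) \<le> \<epsilon> + \<delta>"
      by (intro cINF_lower2[of _ _ y]) (use \<rho>[of x y] in \<open>auto intro!: bdd_belowI[of _ 0]\<close>)
  next
    fix y assume "y \<in> mspace m2"
    with ex2 obtain x where "x \<in> mspace m1" "\<rho> x y < \<epsilon>" by blast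
    with \<open>y \<in> mspace m2\<close> show "(INF x\<in>mspace m1. mdist m (\<phi>1 x) (\<phi>2 y)) \<le> \<epsilon> + \<delta>"
      by (intro cINF_lower2[of _ _ x]) (use \<rho>[of x y] in \<open>auto intro!: bdd_belowI[of _ 0]\<close>)
  qed
  moreover have "prokhorov_dist m (distr \<mu>1 (metric_borel m) \<phi>1) (distr \<mu>2 (metric_borel m) \<phi>2) \<le> \<epsilon> + \<delta>"
    unfolding prokhorov_dist_def
  proof (rule cInf_lower; (intro CollectI conjI ballI)?)
    show "0 < \<epsilon> + \<delta>" using \<epsilon> \<delta> by simp
    fix A assume A: "A \<in> sets (metric_borel m)"
    show "measure (distr \<mu>1 (metric_borel m) \<phi>1) A
         \<le> measure (distr \<mu>2 (metric_borel m) \<phi>2) (metric_nbhd m (\<epsilon> + \<delta>) A) + (\<epsilon> + \<delta>)"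
      using half_close_imp_prokhorov[OF c1 c2 iso1 iso2 h1 \<rho> A] \<delta> by simp
    have \<rho>': "mdist m (\<phi>2 y) (\<phi>1 x) = \<rho> x y + \<delta>" if "y \<in> mspace m2" "x \<in> mspace m1" for x y
      using \<rho>[OF that(2,1)] by (simp add: mdist_commute)
    show "measure (distr \<mu>2 (metric_borel m) \<phi>2) A
         \<le> measure (distr \<mu>1 (metric_borel m) \<phi>1) (metric_nbhd m (\<epsilon> + \<delta>) A) + (\<epsilon> + \<delta>)"
      using half_close_imp_prokhorov[OF c2 c1 iso2 iso1 h2 \<rho>' A] \<delta> by simp
  qed (auto intro!: bdd_belowI[of _ 0])
  ultimately show ?thesis
    using iso1 iso2 unfolding ghp_values_def prod.case
    by (intro bexI[of _ "max (hausdorff_dist m (\<phi>1 ` mspace m1) (\<phi>2 ` mspace m2))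
      (prokhorov_dist m (distr \<mu>1 (metric_borel m) \<phi>1) (distr \<mu>2 (metric_borel m) \<phi>2))"]) auto
qed

lemma half_close_of_ge_1:
  assumes "prob_space \<mu>1" "prob_space \<mu>2" "1 \<le> \<epsilon>"
    and "\<And>x. x \<in> mspace m1 \<Longrightarrow> \<exists>y\<in>mspace m2. \<rho> x y < \<epsilon>"
  shows "half_close \<epsilon> \<rho> (m1, \<mu>1) (m2, \<mu>2)"
  unfolding half_close_def prod.case
proof (intro conjI ballI)
  fix A
  have "measure \<mu>1 A \<le> 1" by (rule prob_space.prob_le_1[OF assms(1)])
  also have "1 \<le> measure \<mu>2 (cross_nbhd m2 \<rho> \<epsilon> A) + \<epsilon>" using assms(3) by (simp add: add_increasing)
  finally show "measure \<mu>1 A \<le> measure \<mu>2 (cross_nbhd m2 \<rho> \<epsilon> A) + \<epsilon>" .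
qed (rule assms(4))

text \<open>A constant that is large compared with both diameters is a cross distance. Hence any two compact
  spaces embed into a common one.\<close>

lemma cross_distance_const:
  assumes "\<And>x x'. x \<in> mspace m1 \<Longrightarrow> x' \<in> mspace m1 \<Longrightarrow> mdist m1 x x' \<le> 2 * K"
    and "\<And>y y'. y \<in> mspace m2 \<Longrightarrow> y' \<in> mspace m2 \<Longrightarrow> mdist m2 y y' \<le> 2 * K"
  shows "cross_distance m1 m2 (\<lambda>_ _. K)"
  using assms by (auto simp: cross_distance_def)

lemma ghp_values_nonempty:
  assumes c1: "compact_mm_space (m1, \<mu>1)" and c2: "compact_mm_space (m2, \<mu>2)"
  shows "ghp_values (m1, \<mu>1) (m2, \<mu>2) \<noteq> {}"
proof -
  obtain K1 where K1: "\<And>x y. x \<in> mspace m1 \<Longrightarrow> y \<in> mspace m1 \<Longrightarrow> mdist m1 x y \<le> K1"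
    using compact_mm_space_bounded[OF c1] by blast
  obtain K2 where K2: "\<And>x y. x \<in> mspace m2 \<Longrightarrow> y \<in> mspace m2 \<Longrightarrow> mdist m2 x y \<le> K2"
    using compact_mm_space_bounded[OF c2] by blast
  define K where "K = max 0 (max K1 K2)"
  have "mdist m1 x x' \<le> 2 * K" if "x \<in> mspace m1" "x' \<in> mspace m1" for x x'
    using K1[OF that] by (simp add: K_def)
  moreover have "mdist m2 x x' \<le> 2 * K" if "x \<in> mspace m2" "x' \<in> mspace m2" for x x'
    using K2[OF that] by (simp add: K_def)
  ultimately have "cross_distance m1 m2 (\<lambda>_ _. K)" by (rule cross_distance_const)
  moreover have "1 \<le> K + 1" by (simp add: K_def)
  ultimately have "close_along (K + 1) (\<lambda>_ _. K) (m1, \<mu>1) (m2, \<mu>2)"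
    using compact_mm_spaceD(1,4)[OF c1] compact_mm_spaceD(1,4)[OF c2]
    by (auto simp: close_along_def intro!: half_close_of_ge_1)
  from ghp_value_of_close_along[OF c1 c2 this zero_less_one] show ?thesis by blast
qed

lemma close_along_self:
  assumes c: "compact_mm_space (m, \<mu>)" and "0 < \<epsilon>"
  shows "close_along \<epsilon> (mdist m) (m, \<mu>) (m, \<mu>)"
proof -
  interpret prob_space \<mu> by (rule compact_mm_spaceD(1)[OF c])
  note s = compact_mm_spaceD[OF c]
  have "half_close \<epsilon> (mdist m) (m, \<mu>) (m, \<mu>)"
    unfolding half_close_def prod.case
  proof (intro conjI ballI)
    fix x assume "x \<in> mspace m"
    then show "\<exists>y\<in>mspace m. mdist m x y < \<epsilon>"
      using \<open>0 < \<epsilon>\<close> by (intro bexI[of _ x]) (simp_all add: mdist_self)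
  next
    fix A assume A: "A \<in> sets \<mu>"
    then have A': "A \<subseteq> mspace m" using sets.sets_into_space s by blast
    have "cross_nbhd m (mdist m) \<epsilon> A \<in> sets \<mu>"
      unfolding s(3) by (intro openin_metric_borel openin_cross_nbhd[OF cross_distance_mdist A'])
    moreover have "A \<subseteq> cross_nbhd m (mdist m) \<epsilon> A"
    proof
      fix x assume "x \<in> A"
      with A' \<open>0 < \<epsilon>\<close> show "x \<in> cross_nbhd m (mdist m) \<epsilon> A"
        by (auto simp: cross_nbhd_def mdist_self intro!: bexI[of _ x])
    qed
    ultimately show "measure \<mu> A \<le> measure \<mu> (cross_nbhd m (mdist m) \<epsilon> A) + \<epsilon>"
      using finite_measure_mono \<open>0 < \<epsilon>\<close> by (smt (verit))
  qed
  moreover have "(\<lambda>y x. mdist m x y) = mdist m" by (simp add: mdist_commute)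
  ultimately show ?thesis by (simp add: close_along_def cross_distance_mdist)
qed

text \<open>Gluing along the middle space: the distance between points of the outer spaces is the length of
  a shortest path through the middle one. This is the triangle inequality for the
  Gromov-Hausdorff-Prokhorov distance.\<close>

lemma cross_distance_compose:
  assumes c12: "cross_distance m1 m2 \<rho>" and c23: "cross_distance m2 m3 \<rho>'" and ne: "mspace m2 \<noteq> {}"
  defines "\<sigma> \<equiv> (\<lambda>x z. INF y\<in>mspace m2. \<rho> x y + \<rho>' y z)"
  shows "cross_distance m1 m3 \<sigma>"
    and "\<lbrakk>x \<in> mspace m1; y \<in> mspace m2; z \<in> mspace m3\<rbrakk> \<Longrightarrow> \<sigma> x z \<le> \<rho> x y + \<rho>' y z"
proof -
  note cd = cross_distanceD[OF c12] and cd' = cross_distanceD[OF c23]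
  have upper: "\<sigma> x z \<le> \<rho> x y + \<rho>' y z"
    if "x \<in> mspace m1" "y \<in> mspace m2" "z \<in> mspace m3" for x y z
    unfolding \<sigma>_def using that cd(5) cd'(5)
    by (intro cINF_lower bdd_belowI[of _ 0]) auto
  have greatest: "c \<le> \<sigma> x z" if "\<And>y. y \<in> mspace m2 \<Longrightarrow> c \<le> \<rho> x y + \<rho>' y z" for x z c
    unfolding \<sigma>_def using that by (intro cINF_greatest[OF ne]) auto
  show "\<lbrakk>x \<in> mspace m1; y \<in> mspace m2; z \<in> mspace m3\<rbrakk> \<Longrightarrow> \<sigma> x z \<le> \<rho> x y + \<rho>' y z" for x y z
    by (rule upper)
  show "cross_distance m1 m3 \<sigma>"
    unfolding cross_distance_def
  proof (intro ballI conjI)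
    fix x x' z z' assume *: "x \<in> mspace m1" "x' \<in> mspace m1" "z \<in> mspace m3" "z' \<in> mspace m3"
    have "\<sigma> x z - mdist m1 x x' \<le> \<sigma> x' z"
    proof (rule greatest)
      fix y assume y: "y \<in> mspace m2"
      show "\<sigma> x z - mdist m1 x x' \<le> \<rho> x' y + \<rho>' y z"
        using upper[OF *(1) y *(3)] cd(1)[OF *(1) y *(2)] by linarith
    qed
    then show "\<sigma> x z \<le> mdist m1 x x' + \<sigma> x' z" by simp
    have "\<sigma> x z - mdist m3 z' z \<le> \<sigma> x z'"
    proof (rule greatest)
      fix y assume y: "y \<in> mspace m2"
      show "\<sigma> x z - mdist m3 z' z \<le> \<rho> x y + \<rho>' y z'"
        using upper[OF *(1) y *(3)] cd'(2)[OF y *(3,4)] by linarith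
    qed
    then show "\<sigma> x z \<le> \<sigma> x z' + mdist m3 z' z" by simp
    have "mdist m1 x x' - \<sigma> x z \<le> \<sigma> x' z"
    proof (rule greatest)
      fix y' assume y': "y' \<in> mspace m2"
      have "mdist m1 x x' - (\<rho> x' y' + \<rho>' y' z) \<le> \<sigma> x z"
      proof (rule greatest)
        fix y assume y: "y \<in> mspace m2"
        show "mdist m1 x x' - (\<rho> x' y' + \<rho>' y' z) \<le> \<rho> x y + \<rho>' y z"
          using cd(3)[OF *(1) y *(2)] cd(2)[OF *(2) y y'] cd'(3)[OF y' *(3) y] by linarith
      qed
      then show "mdist m1 x x' - \<sigma> x z \<le> \<rho> x' y' + \<rho>' y' z" by simp
    qed
    then show "mdist m1 x x' \<le> \<sigma> x z + \<sigma> x' z" by simp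
    have "mdist m3 z z' - \<sigma> x z \<le> \<sigma> x z'"
    proof (rule greatest)
      fix y' assume y': "y' \<in> mspace m2"
      have "mdist m3 z z' - (\<rho> x y' + \<rho>' y' z') \<le> \<sigma> x z"
      proof (rule greatest)
        fix y assume y: "y \<in> mspace m2"
        show "mdist m3 z z' - (\<rho> x y' + \<rho>' y' z') \<le> \<rho> x y + \<rho>' y z"
          using cd'(4)[OF y *(3,4)] cd'(1)[OF y *(4) y'] cd(4)[OF *(1) y y'] by linarith
      qed
      then show "mdist m3 z z' - \<sigma> x z \<le> \<rho> x y' + \<rho>' y' z'" by simp
    qed
    then show "mdist m3 z z' \<le> \<sigma> x z + \<sigma> x z'" by simp
  qed
qed

lemma half_close_compose:
  assumes c1: "compact_mm_space (m1, \<mu>1)" and c2: "compact_mm_space (m2, \<mu>2)"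
    and c3: "compact_mm_space (m3, \<mu>3)"
    and x12: "cross_distance m1 m2 \<rho>" and x23: "cross_distance m2 m3 \<rho>'" and x13: "cross_distance m1 m3 \<sigma>"
    and le: "\<And>x y z. \<lbrakk>x \<in> mspace m1; y \<in> mspace m2; z \<in> mspace m3\<rbrakk> \<Longrightarrow> \<sigma> x z \<le> \<rho> x y + \<rho>' y z"
    and h12: "half_close \<epsilon> \<rho> (m1, \<mu>1) (m2, \<mu>2)" and h23: "half_close \<epsilon>' \<rho>' (m2, \<mu>2) (m3, \<mu>3)"
  shows "half_close (\<epsilon> + \<epsilon>') \<sigma> (m1, \<mu>1) (m3, \<mu>3)"
  unfolding half_close_def prod.case
proof (intro conjI ballI)
  note s1 = compact_mm_spaceD[OF c1] and s2 = compact_mm_spaceD[OF c2] and s3 = compact_mm_spaceD[OF c3]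
  interpret p3: prob_space \<mu>3 by (rule s3)
  {
    fix x assume x: "x \<in> mspace m1"
    then obtain y where y: "y \<in> mspace m2" "\<rho> x y < \<epsilon>" using h12 by (auto simp: half_close_def)
    then obtain z where z: "z \<in> mspace m3" "\<rho>' y z < \<epsilon>'" using h23 by (auto simp: half_close_def)
    with y le[OF x y(1) z(1)] show "\<exists>z\<in>mspace m3. \<sigma> x z < \<epsilon> + \<epsilon>'" by force
  next
    fix A assume A: "A \<in> sets \<mu>1"
    then have A': "A \<subseteq> mspace m1" using sets.sets_into_space s1(2) by blast
    define B where "B = cross_nbhd m2 \<rho> \<epsilon> A"
    have B: "B \<in> sets \<mu>2"
      unfolding s2(3) B_def by (intro openin_metric_borel openin_cross_nbhd[OF x12 A'])
    have C: "cross_nbhd m3 \<sigma> (\<epsilon> + \<epsilon>') A \<in> sets \<mu>3"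
      unfolding s3(3) by (intro openin_metric_borel openin_cross_nbhd[OF x13 A'])
    have "measure \<mu>1 A \<le> measure \<mu>2 B + \<epsilon>"
      using h12 A by (simp add: half_close_def B_def)
    also have "measure \<mu>2 B \<le> measure \<mu>3 (cross_nbhd m3 \<rho>' \<epsilon>' B) + \<epsilon>'"
      using h23 B by (simp add: half_close_def)
    also have "measure \<mu>3 (cross_nbhd m3 \<rho>' \<epsilon>' B) \<le> measure \<mu>3 (cross_nbhd m3 \<sigma> (\<epsilon> + \<epsilon>') A)"
    proof (rule p3.finite_measure_mono[OF _ C], rule subsetI)
      fix z assume "z \<in> cross_nbhd m3 \<rho>' \<epsilon>' B"
      then obtain x y where *: "z \<in> mspace m3" "y \<in> mspace m2" "x \<in> A" "\<rho> x y < \<epsilon>" "\<rho>' y z < \<epsilon>'"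
        by (auto simp: cross_nbhd_def B_def)
      with le[of x y z] A' show "z \<in> cross_nbhd m3 \<sigma> (\<epsilon> + \<epsilon>') A"
        by (force simp: cross_nbhd_def)
    qed
    finally show "measure \<mu>1 A \<le> measure \<mu>3 (cross_nbhd m3 \<sigma> (\<epsilon> + \<epsilon>') A) + (\<epsilon> + \<epsilon>')" by simp
  }
qed

lemma close_along_compose:
  assumes c1: "compact_mm_space (m1, \<mu>1)" and c2: "compact_mm_space (m2, \<mu>2)"
    and c3: "compact_mm_space (m3, \<mu>3)"
    and cl: "close_along \<epsilon> \<rho> (m1, \<mu>1) (m2, \<mu>2)" and cl': "close_along \<epsilon>' \<rho>' (m2, \<mu>2) (m3, \<mu>3)"
  shows "\<exists>\<sigma>. close_along (\<epsilon> + \<epsilon>') \<sigma> (m1, \<mu>1) (m3, \<mu>3)"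
proof -
  define \<sigma> where "\<sigma> = (\<lambda>x z. INF y\<in>mspace m2. \<rho> x y + \<rho>' y z)"
  from cl have x12: "cross_distance m1 m2 \<rho>" and h12: "half_close \<epsilon> \<rho> (m1, \<mu>1) (m2, \<mu>2)"
    and h21: "half_close \<epsilon> (\<lambda>y x. \<rho> x y) (m2, \<mu>2) (m1, \<mu>1)"
    by (auto simp: close_along_def)
  from cl' have x23: "cross_distance m2 m3 \<rho>'" and h23: "half_close \<epsilon>' \<rho>' (m2, \<mu>2) (m3, \<mu>3)"
    and h32: "half_close \<epsilon>' (\<lambda>y x. \<rho>' x y) (m3, \<mu>3) (m2, \<mu>2)"
    by (auto simp: close_along_def)
  note ne = compact_mm_spaceD(4)[OF c2]
  have x13: "cross_distance m1 m3 \<sigma>"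
    unfolding \<sigma>_def by (rule cross_distance_compose(1)[OF x12 x23 ne])
  have le: "\<sigma> x z \<le> \<rho> x y + \<rho>' y z" if "x \<in> mspace m1" "y \<in> mspace m2" "z \<in> mspace m3" for x y z
    unfolding \<sigma>_def by (rule cross_distance_compose(2)[OF x12 x23 ne that])
  have "half_close (\<epsilon> + \<epsilon>') \<sigma> (m1, \<mu>1) (m3, \<mu>3)"
    by (rule half_close_compose[OF c1 c2 c3 x12 x23 x13 le h12 h23])
  moreover have "half_close (\<epsilon>' + \<epsilon>) (\<lambda>z x. \<sigma> x z) (m3, \<mu>3) (m1, \<mu>1)"
    by (rule half_close_compose[OF c3 c2 c1 cross_distance_flip[OF x23] cross_distance_flip[OF x12]
          cross_distance_flip[OF x13] _ h32 h21])
       (use le in \<open>simp add: add.commute\<close>)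
  ultimately show ?thesis
    using x13 by (intro exI[of _ \<sigma>]) (simp add: close_along_def add.commute)
qed

section \<open>Spaces at distance zero\<close>

text \<open>A cross distance may be replaced by a uniformly close one at the price of a larger \<epsilon>.\<close>

lemma half_close_mono:
  assumes c1: "compact_mm_space (m1, \<mu>1)" and c2: "compact_mm_space (m2, \<mu>2)"
    and hc: "half_close \<epsilon>' \<rho>' (m1, \<mu>1) (m2, \<mu>2)" and cross: "cross_distance m1 m2 \<rho>"
    and "\<epsilon>' \<le> \<epsilon>"
    and le: "\<And>x y. x \<in> mspace m1 \<Longrightarrow> y \<in> mspace m2 \<Longrightarrow> \<rho> x y \<le> \<rho>' x y + (\<epsilon> - \<epsilon>')"
  shows "half_close \<epsilon> \<rho> (m1, \<mu>1) (m2, \<mu>2)"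
  unfolding half_close_def prod.case
proof (intro conjI ballI)
  note s1 = compact_mm_spaceD[OF c1] and s2 = compact_mm_spaceD[OF c2]
  interpret p2: prob_space \<mu>2 by (rule s2)
  {
    fix x assume x: "x \<in> mspace m1"
    then obtain y where "y \<in> mspace m2" "\<rho>' x y < \<epsilon>'" using hc by (auto simp: half_close_def)
    with le[OF x, of y] show "\<exists>y\<in>mspace m2. \<rho> x y < \<epsilon>" by force
  next
    fix A assume A: "A \<in> sets \<mu>1"
    then have A': "A \<subseteq> mspace m1" using sets.sets_into_space s1(2) by blast
    have B: "cross_nbhd m2 \<rho> \<epsilon> A \<in> sets \<mu>2"
      unfolding s2(3) by (intro openin_metric_borel openin_cross_nbhd[OF cross A'])
    have "measure \<mu>1 A \<le> measure \<mu>2 (cross_nbhd m2 \<rho>' \<epsilon>' A) + \<epsilon>'"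
      using hc A by (simp add: half_close_def)
    also have "measure \<mu>2 (cross_nbhd m2 \<rho>' \<epsilon>' A) \<le> measure \<mu>2 (cross_nbhd m2 \<rho> \<epsilon> A)"
    proof (rule p2.finite_measure_mono[OF _ B], rule subsetI)
      fix y assume "y \<in> cross_nbhd m2 \<rho>' \<epsilon>' A"
      then obtain x where "y \<in> mspace m2" "x \<in> A" "\<rho>' x y < \<epsilon>'" by (auto simp: cross_nbhd_def)
      with le[of x y] A' show "y \<in> cross_nbhd m2 \<rho> \<epsilon> A" by (force simp: cross_nbhd_def)
    qed
    finally show "measure \<mu>1 A \<le> measure \<mu>2 (cross_nbhd m2 \<rho> \<epsilon> A) + \<epsilon>"
      using assms(5) by linarith
  }
qed

lemma compact_mm_space_finite_net:
  assumes "compact_mm_space (m, \<mu>)" "0 < \<delta>"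
  obtains F where "finite F" "F \<subseteq> mspace m" "\<And>x. x \<in> mspace m \<Longrightarrow> \<exists>z\<in>F. mdist m z x < \<delta>"
proof -
  interpret Metric_space "mspace m" "mdist m" by simp
  have "compactin mtopology (mspace m)"
    using compact_mm_spaceD(5)[OF assms(1)] by (simp add: compact_space_def mtopology_of_def)
  then have "mtotally_bounded (mspace m)" by (rule compactin_imp_mtotally_bounded)
  note this[unfolded mtotally_bounded_def, rule_format, OF assms(2)]
  then obtain F where F: "finite F" "F \<subseteq> mspace m" "mspace m \<subseteq> (\<Union>x\<in>F. mball x \<delta>)"
    by (elim exE conjE)
  show thesis
  proof (rule that[OF F(1,2)])
    fix x assume "x \<in> mspace m"
    with F(3) obtain z where "z \<in> F" "x \<in> mball z \<delta>" by blast
    then show "\<exists>z\<in>F. mdist m z x < \<delta>" unfolding in_mball by blast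
  qed
qed

text \<open>Tychonoff's theorem for products of compact intervals: a uniformly bounded sequence of functions
  has a limit that is approximated, on each finite set, infinitely often.\<close>

lemma bounded_functions_cluster_point:
  fixes R :: "nat \<Rightarrow> 'p \<Rightarrow> real"
  assumes "\<And>n p. R n p \<in> {0..K}"
  obtains g where "\<And>T \<delta> N. finite T \<Longrightarrow> 0 < \<delta> \<Longrightarrow> \<exists>n\<ge>N. \<forall>p\<in>T. \<bar>R n p - g p\<bar> < \<delta>"
proof -
  define Q where "Q = PiE (UNIV :: 'p set) (\<lambda>_. {0..K})"
  have "compactin (product_topology (\<lambda>_::'p. euclidean :: real topology) UNIV) Q"
    unfolding Q_def compactin_PiE by simp
  then have "compact Q" by (simp add: euclidean_product_topology)
  moreover have "filtermap R sequentially \<noteq> bot" by (simp add: filtermap_bot_iff)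
  moreover have "eventually (\<lambda>h. h \<in> Q) (filtermap R sequentially)"
    using assms by (auto simp: eventually_filtermap Q_def PiE_UNIV_domain)
  ultimately obtain g where g: "inf (nhds g) (filtermap R sequentially) \<noteq> bot"
    unfolding compact_filter by blast
  show thesis
  proof (rule that)
    fix T :: "'p set" and \<delta> :: real and N assume T: "finite T" "0 < \<delta>"
    show "\<exists>n\<ge>N. \<forall>p\<in>T. \<bar>R n p - g p\<bar> < \<delta>"
    proof (rule ccontr)
      assume "\<not> ?thesis"
      then have 1: "eventually (\<lambda>h. \<not> (\<forall>p\<in>T. \<bar>h p - g p\<bar> < \<delta>)) (filtermap R sequentially)"
        unfolding eventually_filtermap eventually_sequentially by blast
      have "eventually (\<lambda>h. \<bar>h p - g p\<bar> < \<delta>) (nhds g)" for p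
      proof -
        have "open ((\<lambda>h::'p \<Rightarrow> real. h p) -` {g p - \<delta><..<g p + \<delta>})"
          by (intro open_vimage continuous_on_product_coordinates) simp
        moreover have "g \<in> (\<lambda>h. h p) -` {g p - \<delta><..<g p + \<delta>}" using T(2) by simp
        moreover have "\<forall>h\<in>(\<lambda>h. h p) -` {g p - \<delta><..<g p + \<delta>}. \<bar>h p - g p\<bar> < \<delta>" by auto
        ultimately show ?thesis unfolding eventually_nhds by blast
      qed
      then have 2: "eventually (\<lambda>h. \<forall>p\<in>T. \<bar>h p - g p\<bar> < \<delta>) (nhds g)"
        using T(1) by (simp add: eventually_ball_finite_distrib)
      have "eventually (\<lambda>h. False) (inf (nhds g) (filtermap R sequentially))"
        unfolding eventually_inf using 1 2 by blast
      with g show False by (simp add: trivial_limit_def)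
    qed
  qed
qed

text \<open>The compactness argument behind ``distance zero implies isometric''. Cross distances are bounded
  and 1-Lipschitz in each variable, so a pointwise cluster point of a sequence of them is again a
  cross distance, and by finite nets in both spaces it is approximated uniformly. So a single cross
  distance serves all \<epsilon> simultaneously.\<close>

lemma close_along_limit:
  assumes c1: "compact_mm_space (m1, \<mu>1)" and c2: "compact_mm_space (m2, \<mu>2)"
    and near: "\<And>\<epsilon>. 0 < \<epsilon> \<Longrightarrow> \<exists>\<rho>. close_along \<epsilon> \<rho> (m1, \<mu>1) (m2, \<mu>2)"
  obtains \<rho> where "\<And>\<epsilon>. 0 < \<epsilon> \<Longrightarrow> close_along \<epsilon> \<rho> (m1, \<mu>1) (m2, \<mu>2)"
proof -
  have "\<forall>n. \<exists>\<rho>. close_along (inverse (real (Suc n))) \<rho> (m1, \<mu>1) (m2, \<mu>2)"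
    by (intro allI near) simp
  then obtain \<rho> where \<rho>: "\<And>n. close_along (inverse (real (Suc n))) (\<rho> n) (m1, \<mu>1) (m2, \<mu>2)"
    by metis
  then have cross: "cross_distance m1 m2 (\<rho> n)" for n by (simp add: close_along_def)
  note cd = cross_distanceD[OF cross]
  obtain K where K: "\<And>x y. x \<in> mspace m2 \<Longrightarrow> y \<in> mspace m2 \<Longrightarrow> mdist m2 x y \<le> K"
    using compact_mm_space_bounded[OF c2] by blast
  have \<rho>_le: "\<rho> n x y \<le> 1 + K" if xy: "x \<in> mspace m1" "y \<in> mspace m2" for n x y
  proof -
    obtain y' where y': "y' \<in> mspace m2" "\<rho> n x y' < inverse (real (Suc n))"
      using half_closeD(1)[OF close_alongD(2)[OF \<rho>] xy(1)] by blast
    have "inverse (real (Suc n)) \<le> 1" by (simp add: field_simps)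
    with cd(2)[OF xy y'(1), of n] K[OF y'(1) xy(2)] y'(2) show ?thesis by linarith
  qed
  obtain y0 where "y0 \<in> mspace m2" using compact_mm_spaceD(4)[OF c2] by blast
  with K[of y0 y0] have "0 \<le> K" by (simp add: mdist_self)
  define R where "R = (\<lambda>n p. if fst p \<in> mspace m1 \<and> snd p \<in> mspace m2 then \<rho> n (fst p) (snd p) else 0)"
  have R: "R n p \<in> {0..1 + K}" for n p
    using \<rho>_le cd(5) \<open>0 \<le> K\<close> by (auto simp: R_def)
  obtain g where g: "\<And>T \<delta> N. finite T \<Longrightarrow> 0 < \<delta> \<Longrightarrow> \<exists>n\<ge>N. \<forall>p\<in>T. \<bar>R n p - g p\<bar> < \<delta>"
    using bounded_functions_cluster_point[of R "1 + K", OF R] by blast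
  define \<sigma> where "\<sigma> = (\<lambda>x y. g (x, y))"
  have approx: "\<exists>n\<ge>N. \<forall>x\<in>T1. \<forall>y\<in>T2. \<bar>\<rho> n x y - \<sigma> x y\<bar> < \<delta>"
    if T: "finite T1" "finite T2" "T1 \<subseteq> mspace m1" "T2 \<subseteq> mspace m2" "0 < \<delta>" for T1 T2 \<delta> N
  proof -
    obtain n where n: "n \<ge> N" "\<forall>p\<in>T1 \<times> T2. \<bar>R n p - g p\<bar> < \<delta>"
      using g[OF finite_cartesian_product[OF T(1,2)] T(5)] by blast
    have "\<bar>\<rho> n x y - \<sigma> x y\<bar> < \<delta>" if "x \<in> T1" "y \<in> T2" for x y
    proof -
      have "R n (x, y) = \<rho> n x y"
        using that \<open>T1 \<subseteq> mspace m1\<close> \<open>T2 \<subseteq> mspace m2\<close> by (auto simp: R_def)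
      then show ?thesis using n(2) that by (force simp: \<sigma>_def)
    qed
    with n(1) show ?thesis by blast
  qed
  have cross\<sigma>: "cross_distance m1 m2 \<sigma>"
    unfolding cross_distance_def
  proof (intro ballI)
    fix x x' y y' assume *: "x \<in> mspace m1" "x' \<in> mspace m1" "y \<in> mspace m2" "y' \<in> mspace m2"
    have "\<sigma> x y \<le> mdist m1 x x' + \<sigma> x' y + e \<and> \<sigma> x y \<le> \<sigma> x y' + mdist m2 y' y + e \<and>
        mdist m1 x x' \<le> \<sigma> x y + \<sigma> x' y + e \<and> mdist m2 y y' \<le> \<sigma> x y + \<sigma> x y' + e"
      if "0 < e" for e
    proof -
      obtain n where n: "\<forall>u\<in>{x, x'}. \<forall>v\<in>{y, y'}. \<bar>\<rho> n u v - \<sigma> u v\<bar> < e / 2"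
        using approx[of "{x, x'}" "{y, y'}" "e / 2" 0] * \<open>0 < e\<close> by auto
      from n have "\<bar>\<rho> n x y - \<sigma> x y\<bar> < e / 2" "\<bar>\<rho> n x' y - \<sigma> x' y\<bar> < e / 2"
        "\<bar>\<rho> n x y' - \<sigma> x y'\<bar> < e / 2" by auto
      with cd(1)[OF *(1,3,2), of n] cd(2)[OF *(1,3,4), of n]
        cd(3)[OF *(1,3,2), of n] cd(4)[OF *(1,3,4), of n]
      show ?thesis by linarith
    qed
    note bounds = this
    show "\<sigma> x y \<le> mdist m1 x x' + \<sigma> x' y \<and> \<sigma> x y \<le> \<sigma> x y' + mdist m2 y' y \<and>
        mdist m1 x x' \<le> \<sigma> x y + \<sigma> x' y \<and> mdist m2 y y' \<le> \<sigma> x y + \<sigma> x y'"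
    proof (intro conjI; rule field_le_epsilon)
      fix e :: real assume "0 < e"
      note b = bounds[OF this]
      show "\<sigma> x y \<le> mdist m1 x x' + \<sigma> x' y + e" "\<sigma> x y \<le> \<sigma> x y' + mdist m2 y' y + e"
        "mdist m1 x x' \<le> \<sigma> x y + \<sigma> x' y + e" "mdist m2 y y' \<le> \<sigma> x y + \<sigma> x y' + e"
        using b by simp_all
    qed
  qed
  note cd\<sigma> = cross_distanceD[OF cross\<sigma>]
  have uniform: "\<exists>n\<ge>N. \<forall>x\<in>mspace m1. \<forall>y\<in>mspace m2. \<bar>\<rho> n x y - \<sigma> x y\<bar> < 5 * \<delta>"
    if "0 < \<delta>" for \<delta> N
  proof -
    \<comment> \<open>two Lipschitz steps for each of the two functions and one comparison on the nets give the factor 5\<close>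
    obtain F1 where F1: "finite F1" "F1 \<subseteq> mspace m1" "\<And>x. x \<in> mspace m1 \<Longrightarrow> \<exists>z\<in>F1. mdist m1 z x < \<delta>"
      using compact_mm_space_finite_net[OF c1 \<open>0 < \<delta>\<close>] by blast
    obtain F2 where F2: "finite F2" "F2 \<subseteq> mspace m2" "\<And>x. x \<in> mspace m2 \<Longrightarrow> \<exists>z\<in>F2. mdist m2 z x < \<delta>"
      using compact_mm_space_finite_net[OF c2 \<open>0 < \<delta>\<close>] by blast
    obtain n where n: "n \<ge> N" "\<forall>x\<in>F1. \<forall>y\<in>F2. \<bar>\<rho> n x y - \<sigma> x y\<bar> < \<delta>"
      using approx[OF F1(1) F2(1) F1(2) F2(2) \<open>0 < \<delta>\<close>] by blast
    have "\<bar>\<rho> n x y - \<sigma> x y\<bar> < 5 * \<delta>" if xy: "x \<in> mspace m1" "y \<in> mspace m2" for x y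
    proof -
      from F1(3) xy obtain x' where x': "x' \<in> F1" "mdist m1 x' x < \<delta>" by blast
      from F2(3) xy obtain y' where y': "y' \<in> F2" "mdist m2 y' y < \<delta>" by blast
      have m: "x' \<in> mspace m1" "y' \<in> mspace m2" using x' y' F1(2) F2(2) by auto
      have "\<bar>\<rho> n x' y' - \<sigma> x' y'\<bar> < \<delta>" using n(2) x' y' by blast
      then show ?thesis
        using cd(1)[OF xy m(1), of n] cd(2)[OF m(1) xy(2) m(2), of n]
          cd(1)[OF m xy(1), of n] cd(2)[OF xy(1) m(2) xy(2), of n]
          cd\<sigma>(1)[OF xy m(1)] cd\<sigma>(2)[OF m(1) xy(2) m(2)]
          cd\<sigma>(1)[OF m xy(1)] cd\<sigma>(2)[OF xy(1) m(2) xy(2)] x'(2) y'(2)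
        by (simp add: mdist_commute[of m1 x x'] mdist_commute[of m2 y y'])
    qed
    with n(1) show ?thesis by blast
  qed
  show thesis
  proof (rule that[of \<sigma>])
    fix \<epsilon> :: real assume "0 < \<epsilon>"
    obtain N where N: "inverse (real (Suc N)) < \<epsilon> / 2"
      using reals_Archimedean[of "\<epsilon> / 2"] \<open>0 < \<epsilon>\<close> by auto
    obtain n where n: "n \<ge> N" "\<forall>x\<in>mspace m1. \<forall>y\<in>mspace m2. \<bar>\<rho> n x y - \<sigma> x y\<bar> < 5 * (\<epsilon> / 10)"
      using uniform[of "\<epsilon> / 10" N] \<open>0 < \<epsilon>\<close> by auto
    have "inverse (real (Suc n)) \<le> inverse (real (Suc N))" using n(1) by (simp add: field_simps)
    with N have small: "inverse (real (Suc n)) < \<epsilon> / 2" by linarith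
    have le: "\<sigma> x y \<le> \<rho> n x y + (\<epsilon> - inverse (real (Suc n)))"
      if "x \<in> mspace m1" "y \<in> mspace m2" for x y
    proof -
      have "\<bar>\<rho> n x y - \<sigma> x y\<bar> < 5 * (\<epsilon> / 10)" using n(2) that by blast
      then show ?thesis using small by linarith
    qed
    have \<epsilon>n: "inverse (real (Suc n)) \<le> \<epsilon>" using small \<open>0 < \<epsilon>\<close> by linarith
    have "half_close \<epsilon> \<sigma> (m1, \<mu>1) (m2, \<mu>2)"
      by (rule half_close_mono[OF c1 c2 close_alongD(2)[OF \<rho>] cross\<sigma> \<epsilon>n le])
    moreover have "half_close \<epsilon> (\<lambda>y x. \<sigma> x y) (m2, \<mu>2) (m1, \<mu>1)"
      by (rule half_close_mono[OF c2 c1 close_alongD(3)[OF \<rho>] cross_distance_flip[OF cross\<sigma>] \<epsilon>n le])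
    ultimately show "close_along \<epsilon> \<sigma> (m1, \<mu>1) (m2, \<mu>2)"
      using cross\<sigma> by (simp add: close_along_def)
  qed
qed

lemma cross_distance_attains_zero:
  assumes c2: "compact_mm_space (m2, \<mu>2)" and cross: "cross_distance m1 m2 \<rho>"
    and x: "x \<in> mspace m1" and small: "\<And>\<epsilon>. 0 < \<epsilon> \<Longrightarrow> \<exists>y\<in>mspace m2. \<rho> x y < \<epsilon>"
  shows "\<exists>y\<in>mspace m2. \<rho> x y = 0"
proof -
  note s2 = compact_mm_spaceD[OF c2] and cd = cross_distanceD[OF cross]
  have "Lipschitz_continuous_map m2 euclidean_metric (\<lambda>y. \<rho> x y)"
    unfolding Lipschitz_continuous_map_def
  proof (intro conjI exI[of _ 1] ballI)
    fix y y' assume y: "y \<in> mspace m2" "y' \<in> mspace m2"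
    have "\<bar>\<rho> x y - \<rho> x y'\<bar> \<le> mdist m2 y y'"
      using cd(2)[OF x y] cd(2)[OF x y(2,1)] by (simp add: mdist_commute[of m2 y' y])
    then show "mdist euclidean_metric (\<rho> x y) (\<rho> x y') \<le> 1 * mdist m2 y y'"
      by (simp add: dist_real_def)
  qed simp
  then have "continuous_map (mtopology_of m2) euclidean (\<lambda>y. \<rho> x y)"
    using Lipschitz_continuous_imp_continuous_map by fastforce
  moreover have "compactin (mtopology_of m2) (mspace m2)"
    using s2(5) by (simp add: compact_space_def)
  ultimately have "compactin euclidean ((\<lambda>y. \<rho> x y) ` mspace m2)"
    by (rule image_compactin[rotated])
  then have "compact ((\<lambda>y. \<rho> x y) ` mspace m2)" by simp
  moreover have "(\<lambda>y. \<rho> x y) ` mspace m2 \<noteq> {}" using s2(4) by simp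
  ultimately have "\<exists>s\<in>(\<lambda>y. \<rho> x y) ` mspace m2. \<forall>t\<in>(\<lambda>y. \<rho> x y) ` mspace m2. s \<le> t"
    by (rule compact_attains_inf)
  then obtain y where y: "y \<in> mspace m2" "\<And>y'. y' \<in> mspace m2 \<Longrightarrow> \<rho> x y \<le> \<rho> x y'" by auto
  have "\<rho> x y \<le> 0"
  proof (rule ccontr)
    assume "\<not> \<rho> x y \<le> 0"
    then obtain y' where "y' \<in> mspace m2" "\<rho> x y' < \<rho> x y" using small[of "\<rho> x y"] by auto
    with y(2)[of y'] show False by simp
  qed
  with cd(5)[OF x y(1)] y(1) show ?thesis by (intro bexI[of _ y]) auto
qed

text \<open>The neighbourhoods of a closed set shrink to it, so inequalities up to \<epsilon> become exact.\<close>

lemma measure_closed_le_of_nbhd: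
  assumes "prob_space \<beta>" "sets \<beta> = sets (metric_borel m)"
    and K: "closedin (mtopology_of m) K"
    and le: "\<And>\<epsilon>. 0 < \<epsilon> \<Longrightarrow> c \<le> measure \<beta> (metric_nbhd m \<epsilon> K) + \<epsilon>"
  shows "c \<le> measure \<beta> K"
proof -
  interpret prob_space \<beta> by fact
  define N where "N = (\<lambda>n. metric_nbhd m (inverse (real (Suc n))) K)"
  have K': "K \<subseteq> mspace m" using closedin_subset[OF K] by simp
  have "(\<Inter>n. N n) = K"
  proof (rule antisym[OF subsetI INT_greatest])
    fix n show "K \<subseteq> N n"
    proof
      fix x assume "x \<in> K"
      with K' show "x \<in> N n"
        unfolding N_def metric_nbhd_def by (auto simp: mdist_self intro!: bexI[of _ x])
    qed
  next
    fix x assume x: "x \<in> (\<Inter>n. N n)"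
    then have xm: "x \<in> mspace m" by (auto simp: N_def metric_nbhd_def)
    show "x \<in> K"
    proof (rule ccontr)
      assume "x \<notin> K"
      have "openin (mtopology_of m) (mspace m - K)"
        using K by (simp add: closedin_def)
      then obtain r where r: "0 < r" "\<And>y. y \<in> mspace m \<Longrightarrow> mdist m x y < r \<Longrightarrow> y \<notin> K"
        unfolding openin_mtopology_of using xm \<open>x \<notin> K\<close> by blast
      obtain n where n: "inverse (real (Suc n)) < r" using reals_Archimedean[OF r(1)] by blast
      from x have "x \<in> N n" by blast
      then obtain a where a: "a \<in> K" "mdist m a x < inverse (real (Suc n))"
        by (auto simp: N_def metric_nbhd_def)
      then have "mdist m x a < r" using n mdist_commute[of m x a] by linarith
      with r(2)[of a] a(1) K' show False by blast
    qed
  qed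
  moreover have "range N \<subseteq> sets \<beta>"
    using assms(2) K' unfolding N_def by (auto intro!: openin_metric_borel openin_metric_nbhd)
  moreover have "decseq N"
  proof (rule decseq_SucI, rule subsetI)
    fix n x assume "x \<in> N (Suc n)"
    moreover have "inverse (real (Suc (Suc n))) \<le> inverse (real (Suc n))" by simp
    ultimately show "x \<in> N n" unfolding N_def metric_nbhd_def using less_le_trans by blast
  qed
  ultimately have "(\<lambda>n. measure \<beta> (N n)) \<longlonglongrightarrow> measure \<beta> K"
    using finite_Lim_measure_decseq by metis
  then have "(\<lambda>n. measure \<beta> (N n) + inverse (real (Suc n))) \<longlonglongrightarrow> measure \<beta> K + 0"
    by (intro tendsto_add LIMSEQ_inverse_real_of_nat)
  then show ?thesis
    using le[of "inverse (real (Suc n))" for n]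
    by (intro LIMSEQ_le_const[of _ _ c]) (auto simp: N_def)
qed

lemma measure_eqI_closed:
  assumes "prob_space \<alpha>" "prob_space \<beta>"
    and sets: "sets \<alpha> = sets (metric_borel m)" "sets \<beta> = sets (metric_borel m)"
    and eq: "\<And>K. closedin (mtopology_of m) K \<Longrightarrow> measure \<alpha> K = measure \<beta> K"
  shows "\<alpha> = \<beta>"
proof -
  interpret a: prob_space \<alpha> by fact
  interpret b: prob_space \<beta> by fact
  have sp: "space \<alpha> = mspace m" "space \<beta> = mspace m"
    using sets_eq_imp_space_eq[OF sets(1)] sets_eq_imp_space_eq[OF sets(2)] by auto
  define E where "E = {U. openin (mtopology_of m) U}"
  show ?thesis
  proof (rule measure_eqI_generator_eq[where E = E and \<Omega> = "mspace m" and A = "\<lambda>_. mspace m"])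
    show "Int_stable E" unfolding E_def Int_stable_def by auto
    show "E \<subseteq> Pow (mspace m)" unfolding E_def by (rule openin_mtopology_of_Pow)
    show "sets \<alpha> = sigma_sets (mspace m) E" "sets \<beta> = sigma_sets (mspace m) E"
      using sets by (simp_all add: sets_metric_borel E_def)
    show "range (\<lambda>_. mspace m) \<subseteq> E" using openin_topspace[of "mtopology_of m"] by (auto simp: E_def)
    fix U assume "U \<in> E"
    then have U: "openin (mtopology_of m) U" by (simp add: E_def)
    then have U': "U \<in> sets \<alpha>" "U \<in> sets \<beta>" using sets openin_metric_borel by auto
    have "closedin (mtopology_of m) (mspace m - U)" using U by (simp add: openin_closedin_eq)
    from eq[OF this] have "measure \<alpha> U = measure \<beta> U"
      using a.prob_compl[OF U'(1)] b.prob_compl[OF U'(2)] sp by simp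
    then show "emeasure \<alpha> U = emeasure \<beta> U"
      by (simp add: a.emeasure_eq_measure b.emeasure_eq_measure)
  qed (use a.emeasure_finite in auto)
qed

text \<open>If a cross distance is good for every \<epsilon>, then each point of either space has a point at cross
  distance 0 in the other one, and pairing such points is an isometry. It preserves the measures
  since the two inequalities for closed sets, one from each half of closeness, are exact in the
  limit.\<close>

lemma mm_isometric_of_close_along:
  assumes c1: "compact_mm_space (m1, \<mu>1)" and c2: "compact_mm_space (m2, \<mu>2)"
    and cl: "\<And>\<epsilon>. 0 < \<epsilon> \<Longrightarrow> close_along \<epsilon> \<rho> (m1, \<mu>1) (m2, \<mu>2)"
  shows "mm_isometric (m1, \<mu>1) (m2, \<mu>2)"
proof -
  note s1 = compact_mm_spaceD[OF c1] and s2 = compact_mm_spaceD[OF c2]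
  have cross: "cross_distance m1 m2 \<rho>" by (rule close_alongD(1)[OF cl[OF zero_less_one]])
  note cd = cross_distanceD[OF cross]
  have "\<forall>x\<in>mspace m1. \<exists>y\<in>mspace m2. \<rho> x y = 0"
    using cross_distance_attains_zero[OF c2 cross] half_closeD(1)[OF close_alongD(2)[OF cl]] by blast
  then obtain \<phi> where \<phi>: "\<And>x. x \<in> mspace m1 \<Longrightarrow> \<phi> x \<in> mspace m2"
    "\<And>x. x \<in> mspace m1 \<Longrightarrow> \<rho> x (\<phi> x) = 0" by metis
  have iso: "isometric_embedding m1 m2 \<phi>"
    unfolding isometric_embedding_def
  proof (intro conjI ballI)
    show "\<phi> ` mspace m1 \<subseteq> mspace m2" using \<phi>(1) by blast
    fix x x' assume x: "x \<in> mspace m1" "x' \<in> mspace m1"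
    note y = \<phi>(1)[OF x(1)] \<phi>(1)[OF x(2)]
    show "mdist m2 (\<phi> x) (\<phi> x') = mdist m1 x x'"
      using cd(3)[OF x(1) y(1) x(2)] cd(2)[OF x(2) y(1,2)] cd(4)[OF x(1) y(1,2)] cd(1)[OF x(1) y(2) x(2)]
        \<phi>(2)[OF x(1)] \<phi>(2)[OF x(2)] mdist_commute[of m2 "\<phi> x" "\<phi> x'"] by linarith
  qed
  have \<rho>_ge: "mdist m2 (\<phi> x) y \<le> \<rho> x y" if "x \<in> mspace m1" "y \<in> mspace m2" for x y
    using cd(4)[OF that(1) \<phi>(1)[OF that(1)] that(2)] \<phi>(2)[OF that(1)] by simp
  have onto: "\<phi> ` mspace m1 = mspace m2"
  proof (intro antisym subsetI)
    fix y assume y: "y \<in> mspace m2"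
    have "\<exists>x\<in>mspace m1. \<rho> x y = 0"
      using cross_distance_attains_zero[OF c1 cross_distance_flip[OF cross] y]
        half_closeD(1)[OF close_alongD(3)[OF cl] y] by blast
    then obtain x where x: "x \<in> mspace m1" "\<rho> x y = 0" by blast
    with \<rho>_ge[OF x(1) y] have "mdist m2 (\<phi> x) y = 0" by (simp add: antisym)
    with \<phi>(1)[OF x(1)] y have "\<phi> x = y" by simp
    with x(1) show "y \<in> \<phi> ` mspace m1" by blast
  qed (use \<phi>(1) in blast)
  define \<nu> where "\<nu> = distr \<mu>1 (metric_borel m2) \<phi>"
  have mb: "\<phi> \<in> \<mu>1 \<rightarrow>\<^sub>M metric_borel m2" by (rule mm_isometric_measurable[OF c1 iso])
  have \<nu>: "prob_space \<nu>" "sets \<nu> = sets (metric_borel m2)"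
    unfolding \<nu>_def using prob_space_distr_embedding[OF c1 iso] by simp_all
  interpret p1: prob_space \<mu>1 by (rule s1)
  interpret p2: prob_space \<mu>2 by (rule s2)
  have "\<nu> = \<mu>2"
  proof (rule measure_eqI_closed[OF \<nu>(1) s2(1) \<nu>(2) s2(3)])
    fix K assume K: "closedin (mtopology_of m2) K"
    have K': "K \<subseteq> mspace m2" using closedin_subset[OF K] by simp
    have "mspace m2 - (mspace m2 - K) \<in> sets (metric_borel m2)"
      using K sets.compl_sets[OF openin_metric_borel[of m2 "mspace m2 - K"]]
      by (simp add: closedin_def)
    then have Ks: "K \<in> sets (metric_borel m2)" using K' by (simp add: double_diff)
    have nb: "metric_nbhd m2 \<epsilon> K \<in> sets (metric_borel m2)" for \<epsilon>
      by (intro openin_metric_borel openin_metric_nbhd K')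
    show "measure \<nu> K = measure \<mu>2 K"
    proof (rule antisym)
      show "measure \<nu> K \<le> measure \<mu>2 K"
      proof (rule measure_closed_le_of_nbhd[OF s2(1,3) K])
        fix \<epsilon> :: real assume "0 < \<epsilon>"
        have "measure \<nu> K = measure \<mu>1 (\<phi> -` K \<inter> space \<mu>1)"
          unfolding \<nu>_def by (rule measure_distr[OF mb Ks])
        also have "\<dots> \<le> measure \<mu>2 (cross_nbhd m2 \<rho> \<epsilon> (\<phi> -` K \<inter> space \<mu>1)) + \<epsilon>"
          by (rule half_closeD(2)[OF close_alongD(2)[OF cl[OF \<open>0 < \<epsilon>\<close>]] measurable_sets[OF mb Ks]])
        also have "measure \<mu>2 (cross_nbhd m2 \<rho> \<epsilon> (\<phi> -` K \<inter> space \<mu>1)) \<le> measure \<mu>2 (metric_nbhd m2 \<epsilon> K)"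
        proof (rule p2.finite_measure_mono)
          show "metric_nbhd m2 \<epsilon> K \<in> sets \<mu>2" using nb s2(3) by simp
          show "cross_nbhd m2 \<rho> \<epsilon> (\<phi> -` K \<inter> space \<mu>1) \<subseteq> metric_nbhd m2 \<epsilon> K"
          proof
            fix y assume "y \<in> cross_nbhd m2 \<rho> \<epsilon> (\<phi> -` K \<inter> space \<mu>1)"
            then obtain x where x: "y \<in> mspace m2" "x \<in> mspace m1" "\<phi> x \<in> K" "\<rho> x y < \<epsilon>"
              using s1(2) by (auto simp: cross_nbhd_def)
            with \<rho>_ge[OF x(2,1)] show "y \<in> metric_nbhd m2 \<epsilon> K"
              by (force simp: metric_nbhd_def)
          qed
        qed
        finally show "measure \<nu> K \<le> measure \<mu>2 (metric_nbhd m2 \<epsilon> K) + \<epsilon>" by simp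
      qed
      show "measure \<mu>2 K \<le> measure \<nu> K"
      proof (rule measure_closed_le_of_nbhd[OF \<nu> K])
        fix \<epsilon> :: real assume "0 < \<epsilon>"
        have "measure \<mu>2 K \<le> measure \<mu>1 (cross_nbhd m1 (\<lambda>y x. \<rho> x y) \<epsilon> K) + \<epsilon>"
          using half_closeD(2)[OF close_alongD(3)[OF cl[OF \<open>0 < \<epsilon>\<close>]]] Ks s2(3) by simp
        also have "measure \<mu>1 (cross_nbhd m1 (\<lambda>y x. \<rho> x y) \<epsilon> K)
            \<le> measure \<mu>1 (\<phi> -` metric_nbhd m2 \<epsilon> K \<inter> space \<mu>1)"
        proof (rule p1.finite_measure_mono[OF _ measurable_sets[OF mb nb]], rule subsetI)
          fix x assume "x \<in> cross_nbhd m1 (\<lambda>y x. \<rho> x y) \<epsilon> K"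
          then obtain y where y: "x \<in> mspace m1" "y \<in> K" "\<rho> x y < \<epsilon>" by (auto simp: cross_nbhd_def)
          with K' \<rho>_ge[of x y] have "mdist m2 y (\<phi> x) < \<epsilon>"
            using mdist_commute[of m2 "\<phi> x" y] by force
          with y \<phi>(1) s1(2) show "x \<in> \<phi> -` metric_nbhd m2 \<epsilon> K \<inter> space \<mu>1"
            by (auto simp: metric_nbhd_def)
        qed
        also have "\<dots> = measure \<nu> (metric_nbhd m2 \<epsilon> K)"
          unfolding \<nu>_def by (rule measure_distr[OF mb nb, symmetric])
        finally show "measure \<mu>2 K \<le> measure \<nu> (metric_nbhd m2 \<epsilon> K) + \<epsilon>" by simp
      qed
    qed
  qed
  with iso onto c1 c2 show ?thesis by (auto simp: mm_isometric_def \<nu>_def)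
qed

section \<open>The Gromov-Hausdorff-Prokhorov metric\<close>

lemma abs_mm_space_cases:
  obtains m \<mu> where "a = abs_mm_space (m, \<mu>)" "compact_mm_space (m, \<mu>)"
proof -
  obtain X where X: "mm_isometric X X" "a = abs_mm_space X"
    by (metis Quotient3_abs_rep Quotient3_mm_space Quotient3_rep_reflp)
  then have "compact_mm_space X" by (auto simp: mm_isometric_def split: prod.splits)
  with X(2) that show thesis by (cases X) auto
qed

lemma ghp_dist_abs:
  "compact_mm_space X \<Longrightarrow> compact_mm_space Y \<Longrightarrow>
     ghp_dist (abs_mm_space X) (abs_mm_space Y) = Inf (ghp_values X Y)"
  by (rule ghp_dist.abs_eq) (auto intro: mm_isometric_refl)

lemma ghp_dist_less_imp_close_along:
  assumes c1: "compact_mm_space (m1, \<mu>1)" and c2: "compact_mm_space (m2, \<mu>2)"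
    and "ghp_dist (abs_mm_space (m1, \<mu>1)) (abs_mm_space (m2, \<mu>2)) < \<epsilon>"
  shows "\<exists>\<rho>. close_along \<epsilon> \<rho> (m1, \<mu>1) (m2, \<mu>2)"
proof -
  obtain v where "v \<in> ghp_values (m1, \<mu>1) (m2, \<mu>2)" "v < \<epsilon>"
    using cInf_lessD[OF ghp_values_nonempty[OF c1 c2]] assms(3) by (auto simp: ghp_dist_abs[OF c1 c2])
  then show ?thesis using close_along_of_ghp_value[OF c1 c2] by blast
qed

lemma ghp_dist_le_of_close_along:
  assumes c1: "compact_mm_space (m1, \<mu>1)" and c2: "compact_mm_space (m2, \<mu>2)"
    and cl: "close_along \<epsilon> \<rho> (m1, \<mu>1) (m2, \<mu>2)"
  shows "ghp_dist (abs_mm_space (m1, \<mu>1)) (abs_mm_space (m2, \<mu>2)) \<le> \<epsilon>"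
proof (rule field_le_epsilon)
  fix \<delta> :: real assume "0 < \<delta>"
  then obtain v where v: "v \<in> ghp_values (m1, \<mu>1) (m2, \<mu>2)" "v \<le> \<epsilon> + \<delta>"
    using ghp_value_of_close_along[OF c1 c2 cl] by blast
  have "Inf (ghp_values (m1, \<mu>1) (m2, \<mu>2)) \<le> v"
    using v(1) ghp_values_nonneg[OF c1 c2] by (intro cInf_lower bdd_belowI[of _ 0]) auto
  with v(2) show "ghp_dist (abs_mm_space (m1, \<mu>1)) (abs_mm_space (m2, \<mu>2)) \<le> \<epsilon> + \<delta>"
    by (simp add: ghp_dist_abs[OF c1 c2])
qed

text \<open>The Borel sets of the space of classes are generated by the sets that are open for this metric,
  so this is what makes the measurability of a random space accessible.\<close>

theorem Metric_space_ghp_dist: "Metric_space UNIV ghp_dist"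
proof
  fix a b
  obtain m1 \<mu>1 where a: "a = abs_mm_space (m1, \<mu>1)" and c1: "compact_mm_space (m1, \<mu>1)"
    by (rule abs_mm_space_cases)
  obtain m2 \<mu>2 where b: "b = abs_mm_space (m2, \<mu>2)" and c2: "compact_mm_space (m2, \<mu>2)"
    by (rule abs_mm_space_cases)
  show nonneg: "0 \<le> ghp_dist a b"
    unfolding a b ghp_dist_abs[OF c1 c2]
    by (rule cInf_greatest[OF ghp_values_nonempty[OF c1 c2] ghp_values_nonneg[OF c1 c2]])
  have comm_le: "ghp_dist (abs_mm_space (m', \<mu>')) (abs_mm_space (m, \<mu>))
      \<le> ghp_dist (abs_mm_space (m, \<mu>)) (abs_mm_space (m', \<mu>'))"
    if c: "compact_mm_space (m, \<mu>)" and c': "compact_mm_space (m', \<mu>')" for m \<mu> m' \<mu>'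
  proof (rule dense_ge)
    fix \<epsilon> assume "ghp_dist (abs_mm_space (m, \<mu>)) (abs_mm_space (m', \<mu>')) < \<epsilon>"
    then obtain \<rho> where "close_along \<epsilon> \<rho> (m, \<mu>) (m', \<mu>')"
      using ghp_dist_less_imp_close_along[OF c c'] by blast
    then show "ghp_dist (abs_mm_space (m', \<mu>')) (abs_mm_space (m, \<mu>)) \<le> \<epsilon>"
      by (rule ghp_dist_le_of_close_along[OF c' c close_along_flip])
  qed
  show "ghp_dist a b = ghp_dist b a"
    unfolding a b by (intro antisym comm_le c1 c2)
  show "ghp_dist a b = 0 \<longleftrightarrow> a = b"
  proof
    assume "ghp_dist a b = 0"
    then have "\<exists>\<rho>. close_along \<epsilon> \<rho> (m1, \<mu>1) (m2, \<mu>2)" if "0 < \<epsilon>" for \<epsilon>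
      using ghp_dist_less_imp_close_along[OF c1 c2] that by (simp add: a b)
    then obtain \<rho> where "\<And>\<epsilon>. 0 < \<epsilon> \<Longrightarrow> close_along \<epsilon> \<rho> (m1, \<mu>1) (m2, \<mu>2)"
      using close_along_limit[OF c1 c2] by blast
    then have "mm_isometric (m1, \<mu>1) (m2, \<mu>2)" by (rule mm_isometric_of_close_along[OF c1 c2])
    then show "a = b" unfolding a b by (rule Quotient3_rel_abs[OF Quotient3_mm_space])
  next
    assume "a = b"
    have "ghp_dist a a \<le> 0"
      unfolding a
    proof (rule dense_ge)
      fix \<epsilon> :: real assume "0 < \<epsilon>"
      then show "ghp_dist (abs_mm_space (m1, \<mu>1)) (abs_mm_space (m1, \<mu>1)) \<le> \<epsilon>"
        by (rule ghp_dist_le_of_close_along[OF c1 c1 close_along_self[OF c1]])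
    qed
    with nonneg \<open>a = b\<close> show "ghp_dist a b = 0" by simp
  qed
  fix c
  obtain m3 \<mu>3 where c: "c = abs_mm_space (m3, \<mu>3)" and c3: "compact_mm_space (m3, \<mu>3)"
    by (rule abs_mm_space_cases)
  show "ghp_dist a c \<le> ghp_dist a b + ghp_dist b c"
  proof (rule field_le_epsilon)
    fix e :: real assume "0 < e"
    then obtain \<rho> \<rho>' where
      "close_along (ghp_dist a b + e / 2) \<rho> (m1, \<mu>1) (m2, \<mu>2)"
      "close_along (ghp_dist b c + e / 2) \<rho>' (m2, \<mu>2) (m3, \<mu>3)"
      using ghp_dist_less_imp_close_along[OF c1 c2, of "ghp_dist a b + e / 2"]
        ghp_dist_less_imp_close_along[OF c2 c3, of "ghp_dist b c + e / 2"]
      unfolding a b c by auto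
    from close_along_compose[OF c1 c2 c3 this] obtain \<sigma> where
      "close_along (ghp_dist a b + e / 2 + (ghp_dist b c + e / 2)) \<sigma> (m1, \<mu>1) (m3, \<mu>3)" by blast
    from ghp_dist_le_of_close_along[OF c1 c3 this]
    show "ghp_dist a c \<le> ghp_dist a b + ghp_dist b c + e" by (simp add: a c)
  qed
qed

section \<open>Binary trees with given radii\<close>

definition first_diff :: "(nat \<Rightarrow> bool) \<Rightarrow> (nat \<Rightarrow> bool) \<Rightarrow> nat" where
  "first_diff x y = (LEAST k. x k \<noteq> y k)"

text \<open>The leaves of the infinite binary tree, where two leaves that separate at level k are at distance
  \<open>r k\<close>. For nonincreasing radii this is an ultrametric, and radii tending to 0 make it compact.\<close>

definition cantor_dist :: "(nat \<Rightarrow> real) \<Rightarrow> (nat \<Rightarrow> bool) \<Rightarrow> (nat \<Rightarrow> bool) \<Rightarrow> real" where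
  "cantor_dist r x y = (if x = y then 0 else r (first_diff x y))"

definition tree_radii :: "(nat \<Rightarrow> real) \<Rightarrow> bool" where
  "tree_radii r \<longleftrightarrow> decseq r \<and> (\<forall>k. 0 < r k) \<and> r \<longlonglongrightarrow> 0"

text \<open>Any injection will do, as labels serve only to name points.\<close>

definition cantor_label :: "(nat \<Rightarrow> bool) \<Rightarrow> real" where
  "cantor_label = (SOME f. inj f)"

lemma inj_cantor_label: "inj cantor_label"
proof -
  obtain g :: "nat set \<Rightarrow> real" where g: "inj g"
    using nat_sets_lepoll_reals01 unfolding lepoll_def by blast
  have "inj (\<lambda>x::nat \<Rightarrow> bool. g {k. x k})"
  proof (rule injI)
    fix x y :: "nat \<Rightarrow> bool" assume "g {k. x k} = g {k. y k}"
    then have "{k. x k} = {k. y k}" using g by (simp add: inj_eq)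
    then show "x = y" by (auto simp: set_eq_iff)
  qed
  then show ?thesis unfolding cantor_label_def by (rule someI[of inj])
qed

lemma inv_cantor_label [simp]: "inv cantor_label (cantor_label x) = x"
  by (rule inv_f_f[OF inj_cantor_label])

lemma first_diff_neq: "x \<noteq> y \<Longrightarrow> x (first_diff x y) \<noteq> y (first_diff x y)"
  unfolding first_diff_def by (rule LeastI_ex) (auto simp: fun_eq_iff)

lemma first_diff_eq: "j < first_diff x y \<Longrightarrow> x j = y j"
  unfolding first_diff_def using not_less_Least by blast

lemma first_diff_eqI: "(\<And>j. j < k \<Longrightarrow> x j = y j) \<Longrightarrow> x k \<noteq> y k \<Longrightarrow> first_diff x y = k"
  unfolding first_diff_def by (rule Least_equality) (auto simp: not_less[symmetric])

lemma first_diff_geI: "x \<noteq> y \<Longrightarrow> (\<And>j. j < k \<Longrightarrow> x j = y j) \<Longrightarrow> k \<le> first_diff x y"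
  using first_diff_neq not_less by blast

lemma first_diff_commute: "first_diff x y = first_diff y x"
  unfolding first_diff_def by (simp add: eq_commute)

lemma cantor_dist_commute: "cantor_dist r x y = cantor_dist r y x"
  by (simp add: cantor_dist_def first_diff_commute)

lemma cantor_dist_nonneg: "tree_radii r \<Longrightarrow> 0 \<le> cantor_dist r x y"
  by (auto simp: cantor_dist_def tree_radii_def less_imp_le)

lemma cantor_dist_self [simp]: "cantor_dist r x x = 0"
  by (simp add: cantor_dist_def)

lemma cantor_dist_ultra:
  assumes r: "tree_radii r"
  shows "cantor_dist r x z \<le> max (cantor_dist r x y) (cantor_dist r y z)"
proof (cases "x = y \<or> y = z \<or> x = z")
  case True
  then show ?thesis
    using cantor_dist_nonneg[OF r, of x y] by (auto simp: le_max_iff_disj)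
next
  case False
  let ?k = "first_diff x z"
  have "first_diff x y \<le> ?k \<or> first_diff y z \<le> ?k"
    using first_diff_eq[of ?k x y] first_diff_eq[of ?k y z] first_diff_neq[of x z] False
    by (meson not_less)
  then have "r ?k \<le> r (first_diff x y) \<or> r ?k \<le> r (first_diff y z)"
    using r by (auto simp: tree_radii_def decseq_def)
  with False show ?thesis by (auto simp: cantor_dist_def le_max_iff_disj)
qed

definition cantor_metric :: "(nat \<Rightarrow> real) \<Rightarrow> real metric" where
  "cantor_metric r = metric (range cantor_label,
     \<lambda>a b. cantor_dist r (inv cantor_label a) (inv cantor_label b))"

lemma
  assumes r: "tree_radii r"
  shows mspace_cantor_metric: "mspace (cantor_metric r) = range cantor_label"
    and mdist_cantor_metric:
      "mdist (cantor_metric r) a b = cantor_dist r (inv cantor_label a) (inv cantor_label b)"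
proof -
  interpret Metric_space "range cantor_label"
    "\<lambda>a b. cantor_dist r (inv cantor_label a) (inv cantor_label b)"
  proof
    fix a b c
    show "0 \<le> cantor_dist r (inv cantor_label a) (inv cantor_label b)"
      by (rule cantor_dist_nonneg[OF r])
    show "cantor_dist r (inv cantor_label a) (inv cantor_label b) =
        cantor_dist r (inv cantor_label b) (inv cantor_label a)"
      by (rule cantor_dist_commute)
    show "cantor_dist r (inv cantor_label a) (inv cantor_label c)
        \<le> cantor_dist r (inv cantor_label a) (inv cantor_label b) +
          cantor_dist r (inv cantor_label b) (inv cantor_label c)"
      using cantor_dist_ultra[OF r, of "inv cantor_label a" "inv cantor_label c" "inv cantor_label b"]
        cantor_dist_nonneg[OF r, of "inv cantor_label a" "inv cantor_label b"]
        cantor_dist_nonneg[OF r, of "inv cantor_label b" "inv cantor_label c"] by linarith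
    assume "a \<in> range cantor_label" "b \<in> range cantor_label"
    then show "cantor_dist r (inv cantor_label a) (inv cantor_label b) = 0 \<longleftrightarrow> a = b"
      using r by (auto simp: cantor_dist_def tree_radii_def less_imp_neq[symmetric])
  qed
  show "mspace (cantor_metric r) = range cantor_label"
    "mdist (cantor_metric r) a b = cantor_dist r (inv cantor_label a) (inv cantor_label b)"
    by (simp_all add: cantor_metric_def)
qed

definition coin_tosses :: "(nat \<Rightarrow> bool) measure" where
  "coin_tosses = PiM UNIV (\<lambda>_. measure_pmf (bernoulli_pmf (1/2)))"

lemma prob_space_coin_tosses: "prob_space coin_tosses"
  unfolding coin_tosses_def by (intro prob_space_PiM prob_space_measure_pmf)

lemma space_coin_tosses [simp]: "space coin_tosses = UNIV"
  by (simp add: coin_tosses_def space_PiM PiE_UNIV_domain)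

lemma
  fixes V :: "nat \<Rightarrow> bool set"
  shows sets_coin_cylinder: "{y. \<forall>j<k. y j \<in> V j} \<in> sets coin_tosses"
    and emeasure_coin_cylinder:
      "emeasure coin_tosses {y. \<forall>j<k. y j \<in> V j}
         = (\<Prod>j<k. emeasure (measure_pmf (bernoulli_pmf (1/2))) (V j))"
proof -
  interpret product_prob_space "\<lambda>_::nat. measure_pmf (bernoulli_pmf (1/2))" UNIV
    by unfold_locales
  have eq: "{y. \<forall>j<k. y j \<in> V j} = {y \<in> space (PiM UNIV (\<lambda>_. measure_pmf (bernoulli_pmf (1/2)))).
      \<forall>j\<in>{..<k}. y j \<in> V j}"
    by (auto simp: space_PiM PiE_UNIV_domain)
  show "{y. \<forall>j<k. y j \<in> V j} \<in> sets coin_tosses"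
    unfolding eq coin_tosses_def by measurable
  show "emeasure coin_tosses {y. \<forall>j<k. y j \<in> V j}
      = (\<Prod>j<k. emeasure (measure_pmf (bernoulli_pmf (1/2))) (V j))"
    unfolding eq coin_tosses_def by (rule emeasure_PiM_Collect) auto
qed

lemma emeasure_fair_coin_singleton:
  "emeasure (measure_pmf (bernoulli_pmf (1/2))) {b} = ennreal (1/2)"
  by (cases b) (simp_all add: emeasure_pmf_single)

text \<open>Two independent sequences of fair coin tosses first differ at level k with probability
  \<open>(1/2) ^ Suc k\<close>, even if one of the two is fixed. The distance law of a tree therefore has its
  atoms at the radii, with weights that do not depend on them.\<close>

lemma
  shows sets_first_diff: "{y. x \<noteq> y \<and> first_diff x y = k} \<in> sets coin_tosses"
    and emeasure_first_diff:
      "emeasure coin_tosses {y. x \<noteq> y \<and> first_diff x y = k} = ennreal ((1/2) ^ Suc k)"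
proof -
  define V where "V = (\<lambda>j. if j < k then {x j} else {\<not> x k})"
  have eq: "{y. x \<noteq> y \<and> first_diff x y = k} = {y. \<forall>j<Suc k. y j \<in> V j}"
  proof (intro set_eqI iffI)
    fix y assume "y \<in> {y. x \<noteq> y \<and> first_diff x y = k}"
    then have "x k \<noteq> y k" "\<And>j. j < k \<Longrightarrow> x j = y j"
      using first_diff_neq[of x y] first_diff_eq[of _ x y] by auto
    then show "y \<in> {y. \<forall>j<Suc k. y j \<in> V j}" by (auto simp: V_def less_Suc_eq)
  next
    fix y assume "y \<in> {y. \<forall>j<Suc k. y j \<in> V j}"
    then have *: "x k \<noteq> y k" "\<And>j. j < k \<Longrightarrow> x j = y j"
      by (auto simp: V_def less_Suc_eq)
    then show "y \<in> {y. x \<noteq> y \<and> first_diff x y = k}"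
      using first_diff_eqI[of k x y] by auto
  qed
  show "{y. x \<noteq> y \<and> first_diff x y = k} \<in> sets coin_tosses"
    unfolding eq by (rule sets_coin_cylinder)
  have "emeasure (measure_pmf (bernoulli_pmf (1/2))) (V j) = ennreal (1/2)" for j
    by (simp add: V_def emeasure_fair_coin_singleton)
  then show "emeasure coin_tosses {y. x \<noteq> y \<and> first_diff x y = k} = ennreal ((1/2) ^ Suc k)"
    unfolding eq emeasure_coin_cylinder by (simp only: prod_constant card_lessThan ennreal_power[symmetric])
qed

lemma AE_coin_tosses_neq: "AE y in coin_tosses. x \<noteq> y"
proof -
  have S: "{y. \<forall>j<k. y j \<in> {x j}} \<in> sets coin_tosses" for k by (rule sets_coin_cylinder)
  have "emeasure coin_tosses {x} \<le> ennreal ((1/2) ^ k)" for k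
  proof -
    have "emeasure coin_tosses {x} \<le> emeasure coin_tosses {y. \<forall>j<k. y j \<in> {x j}}"
      by (rule emeasure_mono[OF _ S]) auto
    also have "\<dots> = ennreal ((1/2) ^ k)"
      unfolding emeasure_coin_cylinder emeasure_fair_coin_singleton
      by (simp only: prod_constant card_lessThan ennreal_power[symmetric])
    finally show ?thesis .
  qed
  moreover have "(\<lambda>k. ennreal ((1/2) ^ k)) \<longlonglongrightarrow> ennreal 0"
    by (intro tendsto_ennrealI LIMSEQ_power_zero) simp
  ultimately have "emeasure coin_tosses {x} \<le> 0"
    using LIMSEQ_le_const[of "\<lambda>k. ennreal ((1/2) ^ k)" 0 "emeasure coin_tosses {x}"] by simp
  moreover have "{x} = (\<Inter>k. {y. \<forall>j<k. y j \<in> {x j}})" by (auto simp: fun_eq_iff)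
  then have "{x} \<in> sets coin_tosses" using S by (simp add: sets.countable_INT'')
  ultimately have "{x} \<in> null_sets coin_tosses" by (auto simp: null_sets_def)
  then show ?thesis by (rule AE_I'[where N = "{x}"]) auto
qed

text \<open>Open sets are countable unions of cylinders. This yields measurability for the coin tosses, as
  cylinders are measurable and there are only countably many of them, and continuity from the
  compact product space, as cylinders are open there.\<close>

lemma openin_cantor_metric_eq:
  assumes r: "tree_radii r" and U: "openin (mtopology_of (cantor_metric r)) U"
  shows "cantor_label -` U = (\<Union>l\<in>{l. {y. \<forall>j<length l. y j \<in> {l ! j}} \<subseteq> cantor_label -` U}.
           {y. \<forall>j<length l. y j \<in> {l ! j}})" (is "_ = ?R")
proof (intro antisym subsetI)
  fix x assume "x \<in> cantor_label -` U"
  then obtain e where e: "0 < e" "\<And>y. cantor_dist r x y < e \<Longrightarrow> cantor_label y \<in> U"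
    using U unfolding openin_mtopology_of mspace_cantor_metric[OF r] mdist_cantor_metric[OF r]
    by fastforce
  have "eventually (\<lambda>k. r k < e) sequentially"
    using r e(1) by (intro order_tendstoD(2)[of r 0]) (auto simp: tree_radii_def)
  then obtain k where k: "r k < e" using eventually_happens'[OF sequentially_bot] by blast
  have "{y. \<forall>j<length (map x [0..<k]). y j \<in> {map x [0..<k] ! j}} \<subseteq> cantor_label -` U"
  proof
    fix y assume "y \<in> {y. \<forall>j<length (map x [0..<k]). y j \<in> {map x [0..<k] ! j}}"
    then have agree: "x j = y j" if "j < k" for j using that by auto
    have "cantor_dist r x y < e"
    proof (cases "x = y")
      case False
      then have "r (first_diff x y) \<le> r k"
        using r first_diff_geI[OF _ agree] by (auto simp: tree_radii_def intro: decseqD)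
      with False k show ?thesis by (simp add: cantor_dist_def)
    qed (use e(1) in \<open>simp add: cantor_dist_def\<close>)
    then show "y \<in> cantor_label -` U" using e(2) by simp
  qed
  then show "x \<in> ?R" by (intro UN_I[of "map x [0..<k]"]) auto
qed auto

lemma measurable_cantor_label:
  assumes r: "tree_radii r"
  shows "cantor_label \<in> coin_tosses \<rightarrow>\<^sub>M metric_borel (cantor_metric r)"
  unfolding metric_borel_def
proof (rule measurable_measure_of[OF openin_mtopology_of_Pow])
  show "cantor_label \<in> space coin_tosses \<rightarrow> mspace (cantor_metric r)"
    by (simp add: mspace_cantor_metric[OF r])
  fix U assume "U \<in> {U. openin (mtopology_of (cantor_metric r)) U}"
  then have "cantor_label -` U = (\<Union>l\<in>{l. {y. \<forall>j<length l. y j \<in> {l ! j}} \<subseteq> cantor_label -` U}.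
           {y. \<forall>j<length l. y j \<in> {l ! j}})"
    by (intro openin_cantor_metric_eq[OF r]) simp
  also have "\<dots> \<in> sets coin_tosses"
    by (rule sets.countable_UN''[OF countableI_type sets_coin_cylinder])
  finally show "cantor_label -` U \<inter> space coin_tosses \<in> sets coin_tosses" by simp
qed

lemma compact_space_cantor_metric:
  assumes r: "tree_radii r"
  shows "compact_space (mtopology_of (cantor_metric r))"
proof -
  let ?T = "product_topology (\<lambda>_::nat. discrete_topology (UNIV :: bool set)) UNIV"
  have cyl: "openin ?T {y. \<forall>j<length l. y j \<in> {l ! j}}" for l
  proof -
    have "openin ?T (PiE UNIV (\<lambda>j. if j < length l then {l ! j} else UNIV))"
    proof (rule product_topology_basis)
      show "finite {j. (if j < length l then {l ! j} else UNIV) \<noteq> topspace (discrete_topology UNIV)}"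
        by (rule finite_subset[of _ "{..<length l}"]) auto
    qed simp
    also have "PiE UNIV (\<lambda>j. if j < length l then {l ! j} else UNIV) = {y. \<forall>j<length l. y j \<in> {l ! j}}"
      by (auto simp: PiE_UNIV_domain Pi_iff split: if_splits)
    finally show ?thesis .
  qed
  have "continuous_map ?T (mtopology_of (cantor_metric r)) cantor_label"
    unfolding continuous_map_def
  proof (intro conjI allI impI)
    show "cantor_label \<in> topspace ?T \<rightarrow> topspace (mtopology_of (cantor_metric r))"
      by (simp add: mspace_cantor_metric[OF r])
    fix U assume "openin (mtopology_of (cantor_metric r)) U"
    then have "cantor_label -` U = (\<Union>l\<in>{l. {y. \<forall>j<length l. y j \<in> {l ! j}} \<subseteq> cantor_label -` U}.
           {y. \<forall>j<length l. y j \<in> {l ! j}})"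
      by (rule openin_cantor_metric_eq[OF r])
    also have "openin ?T \<dots>" using cyl by (intro openin_Union) auto
    finally have "openin ?T (cantor_label -` U)" .
    moreover have "{x \<in> topspace ?T. cantor_label x \<in> U} = cantor_label -` U"
      by (auto simp: PiE_UNIV_domain)
    ultimately show "openin ?T {x \<in> topspace ?T. cantor_label x \<in> U}" by simp
  qed
  moreover have "compact_space ?T"
    by (simp add: compact_space_product_topology compact_space_discrete_topology)
  then have "compactin ?T UNIV" by (simp add: compact_space_def PiE_UNIV_domain)
  ultimately have "compactin (mtopology_of (cantor_metric r)) (cantor_label ` UNIV)"
    by (rule image_compactin[rotated])
  then show ?thesis by (simp add: compact_space_def mspace_cantor_metric[OF r])
qed

definition cantor_space :: "(nat \<Rightarrow> real) \<Rightarrow> real metric \<times> real measure" where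
  "cantor_space r = (cantor_metric r, distr coin_tosses (metric_borel (cantor_metric r)) cantor_label)"

lemma compact_mm_space_cantor_space: "tree_radii r \<Longrightarrow> compact_mm_space (cantor_space r)"
  unfolding cantor_space_def compact_mm_space_def prod.case
  by (auto intro!: compact_space_cantor_metric prob_space.prob_space_distr
      prob_space_coin_tosses measurable_cantor_label)

lemma borel_measurable_mdist:
  assumes "a \<in> mspace m"
  shows "mdist m a \<in> borel_measurable (metric_borel m)"
proof (rule borel_measurableI)
  fix S :: "real set" assume S: "open S"
  have "openin (mtopology_of m) (mdist m a -` S \<inter> mspace m)"
    unfolding openin_mtopology_of
  proof (intro conjI ballI)
    fix x assume x: "x \<in> mdist m a -` S \<inter> mspace m"
    then obtain e where e: "0 < e" "ball (mdist m a x) e \<subseteq> S"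
      using S by (auto simp: open_contains_ball)
    show "\<exists>e>0. \<forall>y\<in>mspace m. mdist m x y < e \<longrightarrow> y \<in> mdist m a -` S \<inter> mspace m"
    proof (intro exI[of _ e] conjI ballI impI e(1))
      fix y assume y: "y \<in> mspace m" "mdist m x y < e"
      have "\<bar>mdist m a x - mdist m a y\<bar> < e"
        using mdist_triangle[of a m x y] mdist_triangle[of a m y x] x y assms
          mdist_commute[of m x y] by auto
      with e(2) have "mdist m a y \<in> S" by (auto simp: dist_real_def)
      with y show "y \<in> mdist m a -` S \<inter> mspace m" by simp
    qed
  qed auto
  then show "mdist m a -` S \<inter> space (metric_borel m) \<in> sets (metric_borel m)"
    by (simp add: openin_metric_borel)
qed

text \<open>The integral over the second point is the same for every first point, by the symmetry of the tree.
  The diagonal has measure 0, so that distance 0 does not contribute.\<close>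

lemma pair_distance_prob_cantor_space:
  assumes r: "tree_radii r" and B: "B \<in> sets borel"
  shows "pair_distance_prob (cantor_space r) B = (\<Sum>k. indicator B (r k) * ennreal ((1/2) ^ Suc k))"
proof -
  let ?m = "cantor_metric r"
  let ?\<mu> = "distr coin_tosses (metric_borel ?m) cantor_label"
  interpret prob_space coin_tosses by (rule prob_space_coin_tosses)
  interpret \<mu>: prob_space ?\<mu> by (rule prob_space_distr[OF measurable_cantor_label[OF r]])
  have inner: "(\<integral>\<^sup>+b. indicator B (mdist ?m a b) \<partial>?\<mu>) = (\<Sum>k. indicator B (r k) * ennreal ((1/2) ^ Suc k))"
    if a: "a \<in> range cantor_label" for a
  proof -
    from a obtain x where x: "a = cantor_label x" by blast
    have "a \<in> mspace ?m" using a by (simp add: mspace_cantor_metric[OF r])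
    then have "(\<lambda>b. indicator B (mdist ?m a b) :: ennreal) \<in> borel_measurable (metric_borel ?m)"
      by (rule measurable_compose[OF borel_measurable_mdist borel_measurable_indicator[OF B]])
    then have "(\<integral>\<^sup>+b. indicator B (mdist ?m a b) \<partial>?\<mu>)
        = (\<integral>\<^sup>+y. indicator B (mdist ?m a (cantor_label y)) \<partial>coin_tosses)"
      by (intro nn_integral_distr measurable_cantor_label[OF r]) simp
    also have "\<dots> = (\<integral>\<^sup>+y. (\<Sum>k. indicator B (r k) * indicator {y. x \<noteq> y \<and> first_diff x y = k} y) \<partial>coin_tosses)"
    proof (rule nn_integral_cong_AE)
      show "AE y in coin_tosses. indicator B (mdist ?m a (cantor_label y))
          = (\<Sum>k. indicator B (r k) * indicator {y. x \<noteq> y \<and> first_diff x y = k} y :: ennreal)"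
        using AE_coin_tosses_neq[of x]
      proof eventually_elim
        case (elim y)
        have "(\<Sum>k. indicator B (r k) * indicator {y. x \<noteq> y \<and> first_diff x y = k} y :: ennreal)
            = (\<Sum>k\<in>{first_diff x y}. indicator B (r k) * indicator {y. x \<noteq> y \<and> first_diff x y = k} y)"
          by (rule suminf_finite) auto
        with elim show ?case
          by (simp add: mdist_cantor_metric[OF r] x cantor_dist_def)
      qed
    qed
    also have "\<dots> = (\<Sum>k. \<integral>\<^sup>+y. indicator B (r k) * indicator {y. x \<noteq> y \<and> first_diff x y = k} y \<partial>coin_tosses)"
      using sets_first_diff by (intro nn_integral_suminf) simp
    also have "\<dots> = (\<Sum>k. indicator B (r k) * ennreal ((1/2) ^ Suc k))"
      by (simp only: nn_integral_cmult_indicator[OF sets_first_diff] emeasure_first_diff)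
    finally show ?thesis .
  qed
  have "pair_distance_prob (cantor_space r) B
      = (\<integral>\<^sup>+a. (\<Sum>k. indicator B (r k) * ennreal ((1/2) ^ Suc k)) \<partial>?\<mu>)"
    unfolding pair_distance_prob_def cantor_space_def prod.case
    by (intro nn_integral_cong inner) (simp add: mspace_cantor_metric[OF r])
  then show ?thesis using \<mu>.emeasure_space_1 by simp
qed

lemma distance_kernel_cantor_space:
  assumes "tree_radii r" "B \<in> sets borel"
  shows "distance_kernel (abs_mm_space (cantor_space r)) B
    = (\<Sum>k. indicator B (r k) * ennreal ((1/2) ^ Suc k))"
  using pair_distance_prob_cantor_space[OF assms] compact_mm_space_cantor_space[OF assms(1)]
  by (simp add: distance_kernel.abs_eq mm_isometric_refl)

text \<open>The tree depends continuously on its radii: two trees with uniformly close radii are glued along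
  the maximum of both distances and \<epsilon>, which is a cross distance by the ultrametric inequality,
  and which puts each leaf at distance \<epsilon> from its twin.\<close>

lemma ghp_dist_cantor_space_le:
  assumes r: "tree_radii r" and r': "tree_radii r'" and \<epsilon>: "0 < \<epsilon>"
    and close: "\<And>k. \<bar>r k - r' k\<bar> \<le> \<epsilon>"
  shows "ghp_dist (abs_mm_space (cantor_space r)) (abs_mm_space (cantor_space r')) \<le> 2 * \<epsilon>"
proof -
  define \<rho> where "\<rho> = (\<lambda>a b. max \<epsilon> (max (mdist (cantor_metric r) a b) (mdist (cantor_metric r') a b)))"
  have "\<bar>cantor_dist r x y - cantor_dist r' x y\<bar> \<le> \<epsilon>" for x y
    using close \<epsilon> by (auto simp: cantor_dist_def)
  then have d: "\<bar>mdist (cantor_metric r) a b - mdist (cantor_metric r') a b\<bar> \<le> \<epsilon>" for a b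
    by (simp add: mdist_cantor_metric r r')
  have u: "mdist (cantor_metric r) a c \<le> max (mdist (cantor_metric r) a b) (mdist (cantor_metric r) b c)"
    "mdist (cantor_metric r') a c \<le> max (mdist (cantor_metric r') a b) (mdist (cantor_metric r') b c)" for a b c
    by (simp_all only: mdist_cantor_metric r r' cantor_dist_ultra)
  have cross: "cross_distance (cantor_metric r) (cantor_metric r') \<rho>"
    unfolding cross_distance_def
  proof (intro ballI conjI)
    fix x x' y y'
    note c = mdist_commute[of "cantor_metric r"] and c' = mdist_commute[of "cantor_metric r'"]
    note n = mdist_nonneg[of "cantor_metric r"] and n' = mdist_nonneg[of "cantor_metric r'"]
    show "\<rho> x y \<le> mdist (cantor_metric r) x x' + \<rho> x' y"
      using u[of x y x'] d[of x x'] n[of x x'] unfolding \<rho>_def by linarith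
    show "\<rho> x y \<le> \<rho> x y' + mdist (cantor_metric r') y' y"
      using u[of x y y'] d[of y' y] n'[of y' y] unfolding \<rho>_def by linarith
    show "mdist (cantor_metric r) x x' \<le> \<rho> x y + \<rho> x' y"
      using u(1)[of x x' y] c[of y x'] n[of x y] n[of x' y] unfolding \<rho>_def by linarith
    show "mdist (cantor_metric r') y y' \<le> \<rho> x y + \<rho> x y'"
      using u(2)[of y y' x] c'[of y x] n'[of x y] n'[of x y'] unfolding \<rho>_def by linarith
  qed
  have \<rho>_self: "\<rho> a a = \<epsilon>" if "a \<in> range cantor_label" for a
    using that \<epsilon> by (auto simp: \<rho>_def mdist_cantor_metric r r' cantor_dist_def)
  have half: "half_close (2 * \<epsilon>) \<tau> (cantor_space s) (cantor_space s')"
    if s: "tree_radii s" and s': "tree_radii s'" and cross: "cross_distance (cantor_metric s) (cantor_metric s') \<tau>"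
      and self: "\<And>a. a \<in> range cantor_label \<Longrightarrow> \<tau> a a = \<epsilon>" for s s' \<tau>
    unfolding half_close_def cantor_space_def prod.case mspace_cantor_metric[OF s] mspace_cantor_metric[OF s']
  proof (intro conjI ballI)
    fix a assume "a \<in> range cantor_label"
    then show "\<exists>b\<in>range cantor_label. \<tau> a b < 2 * \<epsilon>" using self \<epsilon> by (intro bexI[of _ a]) auto
  next
    fix A assume "A \<in> sets (distr coin_tosses (metric_borel (cantor_metric s)) cantor_label)"
    then have A: "A \<in> sets (metric_borel (cantor_metric s))" by simp
    then have A': "A \<subseteq> mspace (cantor_metric s)" using sets.sets_into_space by fastforce
    let ?N = "cross_nbhd (cantor_metric s') \<tau> (2 * \<epsilon>) A"
    have N: "?N \<in> sets (metric_borel (cantor_metric s'))"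
      by (intro openin_metric_borel openin_cross_nbhd[OF cross A'])
    interpret prob_space coin_tosses by (rule prob_space_coin_tosses)
    have "measure (distr coin_tosses (metric_borel (cantor_metric s)) cantor_label) A
        = measure coin_tosses (cantor_label -` A \<inter> space coin_tosses)"
      by (rule measure_distr[OF measurable_cantor_label[OF s] A])
    also have "\<dots> \<le> measure coin_tosses (cantor_label -` ?N \<inter> space coin_tosses)"
    proof (rule finite_measure_mono[OF _ measurable_sets[OF measurable_cantor_label[OF s'] N]])
      show "cantor_label -` A \<inter> space coin_tosses \<subseteq> cantor_label -` ?N \<inter> space coin_tosses"
        using self \<epsilon> by (auto simp: cross_nbhd_def mspace_cantor_metric[OF s'] intro!: bexI)
    qed
    also have "\<dots> = measure (distr coin_tosses (metric_borel (cantor_metric s')) cantor_label) ?N"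
      by (rule measure_distr[OF measurable_cantor_label[OF s'] N, symmetric])
    finally show "measure (distr coin_tosses (metric_borel (cantor_metric s)) cantor_label) A
        \<le> measure (distr coin_tosses (metric_borel (cantor_metric s')) cantor_label) ?N + 2 * \<epsilon>"
      using \<epsilon> by simp
  qed
  have "close_along (2 * \<epsilon>) \<rho> (cantor_space r) (cantor_space r')"
    unfolding close_along_def
    using cross half[OF r r' cross \<rho>_self] half[OF r' r cross_distance_flip[OF cross] \<rho>_self]
    by (simp add: cantor_space_def)
  then show ?thesis
    using ghp_dist_le_of_close_along[of "cantor_metric r" _ "cantor_metric r'" _ "2 * \<epsilon>" \<rho>]
      compact_mm_space_cantor_space[OF r] compact_mm_space_cantor_space[OF r']
    by (simp add: cantor_space_def)
qed

section \<open>Random radii\<close>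

text \<open>The preimage of an open set is its interior together with countably many points.\<close>

lemma measurable_ghp_borel_of_countable_discontinuities:
  fixes X :: "real \<Rightarrow> mm_space"
  assumes "countable N" "open S"
    and cont: "\<And>u \<epsilon>. u \<in> S - N \<Longrightarrow> 0 < \<epsilon> \<Longrightarrow> \<forall>\<^sub>F v in nhds u. ghp_dist (X u) (X v) < \<epsilon>"
  shows "X \<in> restrict_space lborel S \<rightarrow>\<^sub>M ghp_borel"
  unfolding ghp_borel_def
proof (rule measurable_measure_of)
  interpret G: Metric_space UNIV ghp_dist by (rule Metric_space_ghp_dist)
  fix U assume "U \<in> {U. Metric_space.mopen UNIV ghp_dist U}"
  then have U: "\<exists>e>0. \<forall>b. ghp_dist a b < e \<longrightarrow> b \<in> U" if "a \<in> U" for a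
    using that unfolding G.mopen_def G.mball_def by blast
  define T where "T = X -` U \<inter> S"
  have "u \<in> interior T" if u: "u \<in> T - N" for u
  proof -
    obtain e where e: "0 < e" "\<And>b. ghp_dist (X u) b < e \<Longrightarrow> b \<in> U"
      using U[of "X u"] u by (auto simp: T_def)
    have "\<forall>\<^sub>F v in nhds u. ghp_dist (X u) (X v) < e"
      using cont[of u e] u e(1) by (auto simp: T_def)
    moreover have "\<forall>\<^sub>F v in nhds u. v \<in> S"
      using \<open>open S\<close> u by (intro eventually_nhds_in_open) (auto simp: T_def)
    ultimately have "\<forall>\<^sub>F v in nhds u. v \<in> T"
      by eventually_elim (simp add: T_def e(2))
    then show ?thesis by (auto simp: eventually_nhds interior_def)
  qed
  then have "T - N \<subseteq> interior T" by (rule subsetI)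
  with interior_subset[of T] have "T = interior T \<union> (T \<inter> N)" by fast
  moreover have "interior T \<in> sets borel" by simp
  moreover have "T \<inter> N \<in> sets borel"
    by (rule sets.countable[OF _ countable_subset[OF Int_lower2 \<open>countable N\<close>]]) simp
  ultimately have "T \<in> sets borel" by (metis sets.Un)
  then show "X -` U \<inter> space (restrict_space lborel S) \<in> sets (restrict_space lborel S)"
    using \<open>open S\<close> by (simp add: space_restrict_space sets_restrict_space_iff T_def)
qed auto

text \<open>Each radius is a monotone function of the parameter and so has countably many jumps. Outside of
  these, finitely many radii are controlled by continuity and all others by the uniform smallness.\<close>

lemma measurable_random_cantor_space:
  fixes rad :: "real \<Rightarrow> nat \<Rightarrow> real"
  assumes "open S"
    and radii: "\<And>u. u \<in> S \<Longrightarrow> tree_radii (rad u)"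
    and mono: "\<And>k. mono_on S (\<lambda>u. rad u k)"
    and unif: "\<And>\<epsilon>. 0 < \<epsilon> \<Longrightarrow> \<exists>k0. \<forall>k\<ge>k0. \<forall>u\<in>S. rad u k \<le> \<epsilon>"
  shows "(\<lambda>u. abs_mm_space (cantor_space (rad u))) \<in> restrict_space lborel S \<rightarrow>\<^sub>M ghp_borel"
proof (rule measurable_ghp_borel_of_countable_discontinuities)
  show "open S" by fact
  define N where "N = (\<Union>k. {u\<in>S. \<not> isCont (\<lambda>u. rad u k) u})"
  show "countable N"
    unfolding N_def using mono_on_ctble_discont_open[OF \<open>open S\<close> mono] by blast
  fix u \<epsilon> assume u: "u \<in> S - N" and \<epsilon>: "(0::real) < \<epsilon>"
  define e where "e = \<epsilon> / 3"
  have e: "0 < e" "2 * e < \<epsilon>" using \<epsilon> by (simp_all add: e_def)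
  obtain k0 where k0: "\<And>k v. k \<ge> k0 \<Longrightarrow> v \<in> S \<Longrightarrow> rad v k \<le> e" using unif[OF e(1)] by blast
  have "\<forall>\<^sub>F v in nhds u. \<bar>rad u k - rad v k\<bar> \<le> e" for k
  proof -
    have "isCont (\<lambda>u. rad u k) u" using u by (auto simp: N_def)
    then have "((\<lambda>v. rad v k) \<longlongrightarrow> rad u k) (nhds u)"
      unfolding isCont_def tendsto_at_iff_tendsto_nhds[of "\<lambda>v. rad v k"] .
    from tendstoD[OF this e(1)] show ?thesis
      by eventually_elim (simp add: dist_real_def abs_minus_commute)
  qed
  then have "\<forall>\<^sub>F v in nhds u. \<forall>k\<in>{..<k0}. \<bar>rad u k - rad v k\<bar> \<le> e"
    by (simp add: eventually_ball_finite_distrib)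
  moreover have "\<forall>\<^sub>F v in nhds u. v \<in> S"
    using \<open>open S\<close> u by (intro eventually_nhds_in_open) auto
  ultimately show "\<forall>\<^sub>F v in nhds u.
      ghp_dist (abs_mm_space (cantor_space (rad u))) (abs_mm_space (cantor_space (rad v))) < \<epsilon>"
  proof eventually_elim
    case (elim v)
    have "\<bar>rad u k - rad v k\<bar> \<le> e" for k
    proof (cases "k < k0")
      case False
      have "0 < rad u k" "0 < rad v k"
        using radii[of u] radii[of v] u elim(2) by (auto simp: tree_radii_def)
      moreover have "rad u k \<le> e" "rad v k \<le> e" using k0[of k] False u elim(2) by auto
      ultimately show ?thesis by linarith
    qed (use elim(1) in auto)
    then have "ghp_dist (abs_mm_space (cantor_space (rad u))) (abs_mm_space (cantor_space (rad v))) \<le> 2 * e"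
      using u elim(2) by (intro ghp_dist_cantor_space_le radii e(1)) auto
    with e(2) show ?case by linarith
  qed
qed

lemma dyadic_interval_cover:
  assumes "0 < v" "v < (1::real)"
  obtains k where "(1/2) ^ Suc k < v \<and> v < (1/2) ^ k \<or> v = (1/2) ^ Suc k"
proof -
  have "\<exists>n. (1/2) ^ n < v" using real_arch_pow_inv[of v "1/2"] assms by auto
  define n where "n = (LEAST n. (1/2) ^ n < v)"
  have n: "(1/2) ^ n < v" unfolding n_def by (rule LeastI_ex) fact
  have "n \<noteq> 0" using n assms(2) by (intro notI) simp
  then obtain k where k: "n = Suc k" by (cases n) auto
  have "\<not> (1/2) ^ k < v" using not_less_Least[of k "\<lambda>n. (1/2) ^ n < v"] k n_def by auto
  show thesis
  proof (cases "v = (1/2) ^ k")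
    case True
    with assms(2) obtain j where "k = Suc j" by (cases k) auto
    with True that[of j] show thesis by simp
  next
    case False
    with \<open>\<not> (1/2) ^ k < v\<close> n k that[of k] show thesis by auto
  qed
qed

text \<open>The map sending u to \<open>(1 + u) / 2 ^ Suc k\<close> takes the uniform law on the unit interval to the uniform
  law on the k-th dyadic interval, between \<open>1 / 2 ^ Suc k\<close> and \<open>1 / 2 ^ k\<close>. The weights
  \<open>1 / 2 ^ Suc k\<close> are the lengths of these intervals, which partition the unit interval up to
  their endpoints.\<close>

lemma nn_integral_dyadic_mixture:
  fixes h :: "real \<Rightarrow> ennreal"
  assumes [measurable]: "h \<in> borel_measurable borel"
  shows "(\<integral>\<^sup>+u. (\<Sum>k. h ((1 + u) * (1/2) ^ Suc k) * ennreal ((1/2) ^ Suc k)) * indicator {0<..<1} u \<partial>lborel)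
     = (\<integral>\<^sup>+v. h v * indicator {0<..<1} v \<partial>lborel)"
proof -
  define J where "J = (\<lambda>k. {(1/2) ^ Suc k<..<(1/2::real) ^ k})"
  have "(\<integral>\<^sup>+u. (\<Sum>k. h ((1 + u) * (1/2) ^ Suc k) * ennreal ((1/2) ^ Suc k)) * indicator {0<..<1} u \<partial>lborel)
      = (\<integral>\<^sup>+u. (\<Sum>k. h ((1 + u) * (1/2) ^ Suc k) * ennreal ((1/2) ^ Suc k) * indicator {0<..<1} u) \<partial>lborel)"
    by (simp add: ennreal_suminf_multc)
  also have "\<dots> = (\<Sum>k. \<integral>\<^sup>+u. h ((1 + u) * (1/2) ^ Suc k) * ennreal ((1/2) ^ Suc k) * indicator {0<..<1} u \<partial>lborel)"
    by (rule nn_integral_suminf) measurable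
  also have "\<dots> = (\<Sum>k. \<integral>\<^sup>+v. h v * indicator (J k) v \<partial>lborel)"
  proof (intro suminf_cong)
    fix k
    define c :: real where "c = (1/2) ^ Suc k"
    have c: "0 < c" "(1/2) ^ k = 2 * c" by (simp_all add: c_def)
    have "c < c + c * u \<longleftrightarrow> 0 < u" "c + c * u < 2 * c \<longleftrightarrow> u < 1" for u
      using c(1) mult_less_cancel_left_pos[of c u 1] by (auto simp: zero_less_mult_iff)
    then have ind: "indicator (J k) (c + c * u) = (indicator {0<..<1} u :: ennreal)" for u
      by (auto simp: J_def c_def[symmetric] c(2) indicator_def)
    have lin: "c + c * u = (1 + u) * c" for u by (simp add: algebra_simps)
    have "(\<integral>\<^sup>+v. h v * indicator (J k) v \<partial>lborel)
        = ennreal \<bar>c\<bar> * (\<integral>\<^sup>+u. h (c + c * u) * indicator (J k) (c + c * u) \<partial>lborel)"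
      using c(1) by (intro nn_integral_real_affine) (auto simp: J_def)
    also have "\<dots> = ennreal c * (\<integral>\<^sup>+u. h ((1 + u) * c) * indicator {0<..<1} u \<partial>lborel)"
      unfolding ind unfolding lin using c(1) by simp
    also have "\<dots> = (\<integral>\<^sup>+u. ennreal c * (h ((1 + u) * c) * indicator {0<..<1} u) \<partial>lborel)"
      by (rule nn_integral_cmult[symmetric]) measurable
    finally show "(\<integral>\<^sup>+u. h ((1 + u) * (1/2) ^ Suc k) * ennreal ((1/2) ^ Suc k) * indicator {0<..<1} u \<partial>lborel)
        = (\<integral>\<^sup>+v. h v * indicator (J k) v \<partial>lborel)"
      unfolding c_def[symmetric] by (simp add: mult_ac)
  qed
  also have "\<dots> = (\<integral>\<^sup>+v. (\<Sum>k. h v * indicator (J k) v) \<partial>lborel)"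
    by (rule nn_integral_suminf[symmetric]) (simp add: J_def)
  also have "\<dots> = (\<integral>\<^sup>+v. h v * indicator {0<..<1} v \<partial>lborel)"
  proof (rule nn_integral_cong_AE)
    have "AE v in lborel. \<forall>k. v \<noteq> (1/2::real) ^ Suc k"
      unfolding AE_all_countable by (intro allI AE_lborel_singleton)
    then show "AE v in lborel. (\<Sum>k. h v * indicator (J k) v) = h v * indicator {0<..<1} v"
    proof eventually_elim
      case (elim v)
      have J_unit: "J k \<subseteq> {0<..<1}" for k
      proof
        fix w assume "w \<in> J k"
        moreover have "(0::real) < (1/2) ^ Suc k" "(1/2::real) ^ k \<le> 1" by (auto intro: power_le_one)
        ultimately show "w \<in> {0<..<1}" unfolding J_def greaterThanLessThan_iff by linarith
      qed
      show ?case
      proof (cases "0 < v \<and> v < 1")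
        case True
        then obtain k where "v \<in> J k"
          using dyadic_interval_cover[of v] elim unfolding J_def by (metis greaterThanLessThan_iff)
        have less_disj: False if "a < b" "v \<in> J a" "v \<in> J b" for a b
        proof -
          have "(1/2::real) ^ b \<le> (1/2) ^ Suc a" using that(1) by (intro power_decreasing) auto
          with that(2,3) show False unfolding J_def greaterThanLessThan_iff by linarith
        qed
        have disj: "v \<notin> J j" if "j \<noteq> k" for j
          using less_disj[of j k] less_disj[of k j] that \<open>v \<in> J k\<close> by (meson nat_neq_iff)
        have "(\<Sum>k. h v * indicator (J k) v) = (\<Sum>k\<in>{k}. h v * indicator (J k) v)"
          by (rule suminf_finite) (use disj in auto)
        with True \<open>v \<in> J k\<close> show ?thesis by simp
      next
        case False
        then have "v \<notin> J k" for k using J_unit[of k] by auto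
        with False show ?thesis by simp
      qed
    qed
  qed
  finally show ?thesis .
qed

lemma sets_borel_of_restrict_atLeast:
  assumes "B \<in> sets (restrict_space borel ({0..} :: real set))"
  shows "B \<in> sets borel"
proof -
  have "({0..} :: real set) \<inter> space borel \<in> sets borel" by simp
  from sets_restrict_space_iff[OF this, of B] assms show ?thesis by simp
qed

text \<open>The k-th radius is the quantile of M at a uniformly distributed level of the k-th dyadic interval.
  One uniform variable serves all levels, which makes the radii nonincreasing in k without any
  further care. They are positive since M has no mass at 0, and they tend to 0 since M charges every
  neighbourhood of 0.\<close>

theorem achieves_of_mass_near_zero:
  assumes M: "real_distribution M" and zero: "measure M {..0} = 0"
    and near: "\<And>x. 0 < x \<Longrightarrow> 0 < measure M {..x}"
    and \<theta>: "\<And>B. B \<in> sets (restrict_space borel {0..}) \<Longrightarrow> emeasure \<theta> B = emeasure M B"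
  shows "\<exists>(P :: real measure) X. random_mm_space P X \<and> achieves P X \<theta>"
proof -
  interpret cdf_distribution M unfolding cdf_distribution_def by (rule M)
  define P where "P = restrict_space lborel {0<..<1::real}"
  \<comment> \<open>the locale's I is the quantile function of M\<close>
  define rad where "rad = (\<lambda>u k. I ((1 + u) * (1/2) ^ Suc k))"
  define X where "X = (\<lambda>u. abs_mm_space (cantor_space (rad u)))"
  have level: "(1/2) ^ Suc k < (1 + u) * (1/2) ^ Suc k" "(1 + u) * (1/2) ^ Suc k < (1/2) ^ k"
    if "u \<in> {0<..<1}" for u :: real and k
    using that by (auto simp: field_simps)
  have level01: "(1 + u) * (1/2) ^ Suc k \<in> {0<..<1}" if "u \<in> {0<..<1}" for u :: real and k
  proof -
    have "(0::real) < (1/2) ^ Suc k" "(1/2::real) ^ k \<le> 1" by (auto intro: power_le_one)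
    with level[OF that, of k] show ?thesis unfolding greaterThanLessThan_iff by linarith
  qed
  have I_mono: "I a \<le> I b" if "a \<in> {0<..<1}" "b \<in> {0<..<1}" "a \<le> b" for a b
    using mono_I that by (auto simp: mono_on_def)
  have I_pos: "0 < I a" if "a \<in> {0<..<1}" for a
    using pseudoinverse[of a 0] that zero by (auto simp: cdf_def not_le[symmetric])
  have unif: "\<exists>k0. \<forall>k\<ge>k0. \<forall>u\<in>{0<..<1}. rad u k \<le> \<epsilon>" if \<epsilon>: "0 < \<epsilon>" for \<epsilon>
  proof -
    have "0 < C \<epsilon>" using near[OF \<epsilon>] by (simp add: cdf_def)
    then obtain k0 where k0: "(1/2) ^ k0 < C \<epsilon>" using real_arch_pow_inv[of "C \<epsilon>" "1/2"] by auto
    have "rad u k \<le> \<epsilon>" if "k \<ge> k0" "u \<in> {0<..<1}" for k u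
    proof -
      have "(1/2::real) ^ k \<le> (1/2) ^ k0" using that(1) by (intro power_decreasing) auto
      with k0 level(2)[OF that(2), of k] have "(1 + u) * (1/2) ^ Suc k \<le> C \<epsilon>" by linarith
      then show ?thesis
        using pseudoinverse[of "(1 + u) * (1/2) ^ Suc k" \<epsilon>] level01[OF that(2), of k]
        by (simp add: rad_def)
    qed
    then show ?thesis by blast
  qed
  have radii: "tree_radii (rad u)" if u: "u \<in> {0<..<1}" for u
    unfolding tree_radii_def
  proof (intro conjI allI)
    show "decseq (rad u)"
    proof (rule decseq_SucI)
      fix k
      have "(1 + u) * (1/2) ^ Suc (Suc k) \<le> (1 + u) * (1/2) ^ Suc k" using u by simp
      then show "rad u (Suc k) \<le> rad u k"
        unfolding rad_def by (intro I_mono level01 u)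
    qed
    show pos: "0 < rad u k" for k unfolding rad_def by (intro I_pos level01 u)
    show "rad u \<longlonglongrightarrow> 0"
    proof (rule LIMSEQ_I)
      fix e :: real assume "0 < e"
      then obtain k0 where "\<forall>k\<ge>k0. \<forall>u\<in>{0<..<1}. rad u k \<le> e / 2" using unif[of "e / 2"] by auto
      with u have "\<And>k. k \<ge> k0 \<Longrightarrow> rad u k \<le> e / 2" by blast
      with pos \<open>0 < e\<close> show "\<exists>k0. \<forall>k\<ge>k0. norm (rad u k - 0) < e"
        by (intro exI[of _ k0]) (force simp: abs_of_pos)
    qed
  qed
  have "mono_on {0<..<1} (\<lambda>u. rad u k)" for k
  proof (rule mono_onI)
    fix u v :: real assume uv: "u \<in> {0<..<1}" "v \<in> {0<..<1}" "u \<le> v"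
    then have "(1 + u) * (1/2) ^ Suc k \<le> (1 + v) * (1/2) ^ Suc k" by simp
    then show "rad u k \<le> rad v k" unfolding rad_def by (intro I_mono level01 uv)
  qed
  then have "X \<in> P \<rightarrow>\<^sub>M ghp_borel"
    unfolding X_def P_def
    by (intro measurable_random_cantor_space radii unif) auto
  moreover have "prob_space P"
    unfolding P_def by (rule prob_spaceI) (simp add: emeasure_restrict_space space_restrict_space)
  moreover have "achieves P X \<theta>"
    unfolding achieves_def
  proof
    fix B :: "real set" assume B: "B \<in> sets (restrict_space borel {0..})"
    then have B': "B \<in> sets borel" by (rule sets_borel_of_restrict_atLeast)
    define h where "h = (\<lambda>v. indicator B (I v) * indicator {0<..<1} v :: ennreal)"
    have h_restrict: "(\<lambda>v. indicator B (I v) :: ennreal) \<in> borel_measurable (restrict_space borel {0<..<1})"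
      by (rule measurable_compose[OF measurable_CI borel_measurable_indicator[OF B']])
    have h: "h \<in> borel_measurable borel"
      using h_restrict unfolding h_def
      by (subst (asm) borel_measurable_restrict_space_iff_ennreal) auto
    have "emeasure \<theta> B = emeasure M B" by (rule \<theta>[OF B])
    also have "\<dots> = emeasure (distr P borel I) B" unfolding P_def by (simp add: distr_I_eq_M)
    also have "\<dots> = (\<integral>\<^sup>+v. indicator B v \<partial>distr P borel I)" using B' by simp
    also have "\<dots> = (\<integral>\<^sup>+v. indicator B (I v) \<partial>P)"
      using B' measurable_CI unfolding P_def
      by (intro nn_integral_distr) (auto cong: measurable_cong_sets sets_restrict_space_cong)
    also have "\<dots> = (\<integral>\<^sup>+v. h v * indicator {0<..<1} v \<partial>lborel)"
      unfolding P_def h_def by (subst nn_integral_restrict_space) (auto intro!: nn_integral_cong simp: indicator_def)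
    also have "\<dots> = (\<integral>\<^sup>+u. (\<Sum>k. h ((1 + u) * (1/2) ^ Suc k) * ennreal ((1/2) ^ Suc k)) * indicator {0<..<1} u \<partial>lborel)"
      by (rule nn_integral_dyadic_mixture[OF h, symmetric])
    also have "\<dots> = (\<integral>\<^sup>+u. (\<Sum>k. h ((1 + u) * (1/2) ^ Suc k) * ennreal ((1/2) ^ Suc k)) \<partial>P)"
      unfolding P_def by (subst nn_integral_restrict_space) auto
    also have "\<dots> = (\<integral>\<^sup>+u. distance_kernel (X u) B \<partial>P)"
    proof (rule nn_integral_cong)
      fix u assume "u \<in> space P"
      then have u: "u \<in> {0<..<1}" by (simp add: P_def space_restrict_space)
      have "h ((1 + u) * (1/2) ^ Suc k) = indicator B (rad u k)" for k
        unfolding h_def rad_def using level01[OF u, of k] by simp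
      then show "(\<Sum>k. h ((1 + u) * (1/2) ^ Suc k) * ennreal ((1/2) ^ Suc k)) = distance_kernel (X u) B"
        unfolding X_def distance_kernel_cantor_space[OF radii[OF u] B'] by simp
    qed
    finally show "emeasure \<theta> B = (\<integral>\<^sup>+u. distance_kernel (X u) B \<partial>P)" .
  qed
  ultimately show ?thesis unfolding random_mm_space_def by blast
qed

theorem corollary1:
  fixes f :: "real \<Rightarrow> real"
  assumes "continuous_on {0..} f"
    and "\<And>x. 0 \<le> x \<Longrightarrow> 0 \<le> f x"
    and "(\<integral>\<^sup>+x. ennreal (f x) \<partial>lborel_nonneg) = 1"
    and "\<exists>\<eta>>0. \<forall>x\<in>{0<..\<eta>}. 0 < f x"
  shows "\<exists>(P :: real measure) X. random_mm_space P X \<and>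
           achieves P X (density lborel_nonneg (\<lambda>x. ennreal (f x)))"
proof -
  define g where "g = (\<lambda>x. ennreal (f x) * indicator {0..} x)"
  define M where "M = density lborel g"
  have f: "f \<in> borel_measurable (restrict_space borel {0..})"
    by (rule borel_measurable_continuous_on_restrict[OF assms(1)])
  then have f': "(\<lambda>x. ennreal (f x)) \<in> borel_measurable lborel_nonneg"
    by (intro measurable_compose[OF _ measurable_ennreal]) (simp cong: measurable_cong_sets sets_restrict_space_cong)
  have g[measurable]: "g \<in> borel_measurable borel"
    using f' unfolding g_def
    by (subst (asm) borel_measurable_restrict_space_iff_ennreal) auto
  have int_g: "(\<integral>\<^sup>+x. g x * indicator A x \<partial>lborel) = (\<integral>\<^sup>+x. ennreal (f x) * indicator A x \<partial>lborel_nonneg)" for A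
    unfolding g_def by (subst nn_integral_restrict_space) (auto intro!: nn_integral_cong simp: mult_ac)
  have emeasure_M: "emeasure M A = (\<integral>\<^sup>+x. g x * indicator A x \<partial>lborel)" if "A \<in> sets borel" for A
    unfolding M_def using that by (intro emeasure_density) auto
  have "emeasure M (space M) = 1"
    using int_g[of UNIV] assms(3) by (subst emeasure_M) (auto simp: M_def)
  then interpret M: prob_space M by (rule prob_spaceI)
  have M: "real_distribution M"
    by unfold_locales (auto simp: M_def)
  show ?thesis
  proof (rule achieves_of_mass_near_zero[OF M])
    have "AE x in lborel. g x * indicator {..0} x = 0"
      using AE_lborel_singleton[of "0::real"] by eventually_elim (auto simp: g_def indicator_def)
    then have "emeasure M {..0} = 0"
      by (subst emeasure_M) (auto simp: nn_integral_0_iff_AE)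
    then show "measure M {..0} = 0" by (simp add: measure_def)
  next
    fix x :: real assume x: "0 < x"
    obtain \<eta> where \<eta>: "0 < \<eta>" "\<And>x. x \<in> {0<..\<eta>} \<Longrightarrow> 0 < f x" using assms(4) by blast
    have "measure M {..x} \<noteq> 0"
    proof
      assume "measure M {..x} = 0"
      then have "emeasure M {..x} = 0" by (simp add: M.emeasure_eq_measure)
      then have "AE y in lborel. g y * indicator {..x} y = 0"
        by (subst (asm) emeasure_M) (auto simp: nn_integral_0_iff_AE)
      then have "AE y in lborel. y \<notin> {0<..min x \<eta>}"
      proof eventually_elim
        case (elim y)
        show ?case
        proof
          assume "y \<in> {0<..min x \<eta>}"
          with elim \<eta>(2)[of y] show False by (auto simp: g_def ennreal_eq_0_iff)
        qed
      qed
      then have "emeasure lborel {0<..min x \<eta>} = 0"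
        by (subst (asm) AE_iff_measurable[where N = "{0<..min x \<eta>}"]) auto
      with x \<eta>(1) show False by simp
    qed
    then show "0 < measure M {..x}" using measure_nonneg[of M "{..x}"] by linarith
  next
    fix B assume B: "B \<in> sets (restrict_space borel ({0..} :: real set))"
    then have "B \<in> sets borel" by (rule sets_borel_of_restrict_atLeast)
    moreover have "B \<in> sets lborel_nonneg" using B by (simp add: sets_restrict_space)
    ultimately show "emeasure (density lborel_nonneg (\<lambda>x. ennreal (f x))) B = emeasure M B"
      using f' by (simp add: emeasure_density emeasure_M int_g)
  qed
qed

end
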